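(* Let $a>0$, $b>0$, $c\in(0,1)$, let $X=(X_t)_{t\ge0}$ be the tempered stable subordinator with parameters $(a,b;c)$, and let $\tilde X_t=\frac1t\int_0^t X_s\,\mathrm{d}s$ for $t>0$, $\tilde X_0=0$. Then for all $t\ge0$ and all complex $u$ for which $\mathbb{E}e^{-u\tilde X_t}$ is well defined, the Lévy–Khintchine representation $$\log\mathbb{E}e^{-u\tilde X_t}=t\left(-\tilde\alpha u+\frac{\tilde\beta^2u^2}{2}+\int_{\mathbb{R}\setminus\{0\}}\left(e^{-ux}-1+ux\mathbf{1}_{\{|x|<1\}}\right)\tilde\nu(\mathrm{d}x)\right)$$ holds with Lévy triplet $(\tilde\alpha,\tilde\beta,\tilde\nu)$ given by $$\tilde\alpha=\frac{a}{2b^{1-c}}\left(\Gamma(1-c)+\frac{\Gamma(2-c,b)-2\Gamma(1-c,b)-b^{2}\Gamma(-c,b)}{c+1}\right),\qquad \tilde\beta=0,$$ and $\tilde\nu(\mathrm{d}x)=\tilde\ell(x)\,\mathrm{d}x$ with Lévy density $$\tilde\ell(x)=\frac{a}{c+1}\left(\frac{e^{-bx}}{x^{c+1}}-b^{c+1}\Gamma(-c,bx)\right)\mathbf{1}_{(0,\infty)}(x),\qquad x\in\mathbb{R}.$$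
   Context: For $a>0$, $b>0$, $c\in(0,1)$, the tempered stable subordinator with parameters $(a,b;c)$ is the (càdlàg, nondecreasing) Lévy process $X=(X_t)_{t\ge0}$, $X_0=0$ a.s., with marginal Laplace transform $\mathbb{E}e^{-uX_t}=\exp\left(at\,\Gamma(-c)\left((b+u)^c-b^c\right)\right)$ for $\mathrm{Re}\,u>-b$ (principal branches). $\Gamma(\cdot)$ is the gamma function and $\Gamma(s,y)=\int_y^\infty z^{s-1}e^{-z}\,\mathrm{d}z$ ($y>0$) is the upper incomplete gamma function. In a Lévy triplet, $\tilde\alpha\in\mathbb{R}$ is the drift component (relative to the truncation $\mathbf{1}_{\{|x|<1\}}$), $\tilde\beta\ge0$ is the Brownian component, and $\tilde\nu$ is the Lévy (jump intensity) measure on $\mathbb{R}\setminus\{0\}$, satisfying $\int(1\wedge x^2)\tilde\nu(\mathrm{d}x)<\infty$. The logarithm is the continuous one vanishing at $u=0$. *)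

theory Defs
  imports "HOL-Probability.Probability"
begin

text \<open>Time is \<open>real\<close>, restricted to \<open>t \<ge> 0\<close>; the path conditions hold for every sample point.\<close>

locale levy_process = prob_space M for M :: "'a measure" +
  fixes X :: "real \<Rightarrow> 'a \<Rightarrow> real"
  assumes measurable_X: "\<And>t. 0 \<le> t \<Longrightarrow> X t \<in> borel_measurable M"
    and start_zero: "AE \<omega> in M. X 0 \<omega> = 0"
    and indep_increments: "\<And>(n::nat) \<tau>. 0 \<le> \<tau> 0 \<Longrightarrow> (\<And>i. i < n \<Longrightarrow> \<tau> i < \<tau> (Suc i)) \<Longrightarrow>
      indep_vars (\<lambda>_. borel) (\<lambda>i \<omega>. X (\<tau> (Suc i)) \<omega> - X (\<tau> i) \<omega>) {..<n}"
    and stationary_increments: "\<And>s t. 0 \<le> s \<Longrightarrow> s \<le> t \<Longrightarrow>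
      distr M borel (\<lambda>\<omega>. X t \<omega> - X s \<omega>) = distr M borel (X (t - s))"
    and right_continuous: "\<And>\<omega> t. \<omega> \<in> space M \<Longrightarrow> 0 \<le> t \<Longrightarrow>
      continuous (at_right t) (\<lambda>s. X s \<omega>)"
    and left_limits: "\<And>\<omega> t. \<omega> \<in> space M \<Longrightarrow> 0 < t \<Longrightarrow>
      \<exists>l. ((\<lambda>s. X s \<omega>) \<longlongrightarrow> l) (at_left t)"

locale subordinator = levy_process M X for M :: "'a measure" and X :: "real \<Rightarrow> 'a \<Rightarrow> real" +
  assumes nondecreasing: "\<And>\<omega>. \<omega> \<in> space M \<Longrightarrow> mono_on {0..} (\<lambda>t. X t \<omega>)"

definition laplace_domain :: "'a measure \<Rightarrow> ('a \<Rightarrow> real) \<Rightarrow> complex set" where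
  "laplace_domain M Y = {u. integrable M (\<lambda>\<omega>. exp (- u * of_real (Y \<omega>)))}"

definition laplace_transform :: "'a measure \<Rightarrow> ('a \<Rightarrow> real) \<Rightarrow> complex \<Rightarrow> complex" where
  "laplace_transform M Y u = (\<integral>\<omega>. exp (- u * of_real (Y \<omega>)) \<partial>M)"

locale tempered_stable_subordinator = subordinator M X
  for M :: "'a measure" and X :: "real \<Rightarrow> 'a \<Rightarrow> real" +
  fixes a b c :: real
  assumes laplace_domain_X: "\<And>t u. 0 \<le> t \<Longrightarrow> Re u > - b \<Longrightarrow> u \<in> laplace_domain M (X t)"
    and laplace_transform_X: "\<And>t u. 0 \<le> t \<Longrightarrow> Re u > - b \<Longrightarrow>
      laplace_transform M (X t) u =
        exp (of_real (a * t * Gamma (- c)) * ((of_real b + u) powr of_real c - of_real (b powr c)))"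

definition time_average :: "(real \<Rightarrow> 'a \<Rightarrow> real) \<Rightarrow> real \<Rightarrow> 'a \<Rightarrow> real" where
  "time_average X t \<omega> = (if t = 0 then 0 else 1 / t * (LBINT s:{0..t}. X s \<omega>))"

text \<open>Meaningful for every real \<open>s\<close>, negative ones included, provided \<open>y > 0\<close>.\<close>

definition upper_Gamma :: "real \<Rightarrow> real \<Rightarrow> real" where
  "upper_Gamma s y = (LBINT z:{y..}. z powr (s - 1) * exp (- z))"

text \<open>A measure on \<open>\<real> \<setminus> {0}\<close> is represented as a Borel measure on \<open>\<real>\<close> without mass at 0.\<close>

definition levy_measure :: "real measure \<Rightarrow> bool" where
  "levy_measure \<nu> \<longleftrightarrow> sets \<nu> = sets borel \<and> emeasure \<nu> {0} = 0 \<and>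
     (\<integral>\<^sup>+ x. ennreal (min 1 (x\<^sup>2)) \<partial>\<nu>) < \<infinity>"

definition levy_khintchine_integrand :: "complex \<Rightarrow> real \<Rightarrow> complex" where
  "levy_khintchine_integrand u x =
     exp (- u * of_real x) - 1 + u * of_real x * indicator {x. \<bar>x\<bar> < 1} x"

definition levy_khintchine_exponent :: "real \<Rightarrow> real \<Rightarrow> real measure \<Rightarrow> complex \<Rightarrow> complex" where
  "levy_khintchine_exponent \<alpha> \<beta> \<nu> u =
     - of_real \<alpha> * u + (of_real \<beta>)\<^sup>2 * u\<^sup>2 / 2 +
     (LINT x:- {0}|\<nu>. levy_khintchine_integrand u x)"

definition is_continuous_log :: "complex set \<Rightarrow> (complex \<Rightarrow> complex) \<Rightarrow> (complex \<Rightarrow> complex) \<Rightarrow> bool" where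
  "is_continuous_log D f L \<longleftrightarrow> continuous_on D L \<and> L 0 = 0 \<and> (\<forall>u\<in>D. exp (L u) = f u)"

text \<open>The value is determined whenever \<open>D\<close> is connected with \<open>0 \<in> D\<close> and some continuous
  logarithm of \<open>f\<close> on \<open>D\<close> vanishing at 0 exists.\<close>

definition continuous_log :: "complex set \<Rightarrow> (complex \<Rightarrow> complex) \<Rightarrow> complex \<Rightarrow> complex" where
  "continuous_log D f u = (THE z. \<exists>L. is_continuous_log D f L \<and> z = L u)"

end

theory Submission
  imports Defs "HOL-Real_Asymp.Real_Asymp"
begin

text \<open>
  Let \<open>\<phi> u = \<Gamma>(-c) ((b + u)\<^sup>c - b\<^sup>c)\<close>. Writing the time average \<open>Y\<^sub>t\<close> as a limit of Riemann sums, i.e. of sums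
  of independent increments with weights \<open>k/n\<close>, gives \<open>log E exp (-u Y\<^sub>t) = a t \<integral>\<^sub>0\<^sup>1 \<phi>(u y) dy\<close> for
  \<open>Re u > -b\<close>, and \<open>u\<close> times this has the derivative \<open>a t \<phi> u\<close>. On the other side,
  the unnormalised density \<open>l\<close> (without the factor \<open>a/(c+1)\<close>) satisfies
  \<open>l' x = -(c+1) x powr (-c-2) exp (-b x)\<close>, so that integrating the derivative of
  \<open>x (exp (-u x) - 1) l x\<close> over \<open>(0,\<infinity>)\<close> shows that \<open>u \<integral> (exp (-u x) - 1) l x dx\<close> has the derivative
  \<open>(c+1) \<integral> (exp (-u x) - 1) x powr (-c-1) exp (-b x) dx = (c+1) \<phi> u\<close>.
  Both sides extend continuously to \<open>Re u = -b\<close>, because \<open>l x \<le> x powr (-c-1) exp (-b x)\<close>.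
  For \<open>Re u < -b\<close> the transform is infinite: the average dominates \<open>(1 - 1/n) X\<^sub>t\<^sub>/\<^sub>n\<close>, and
  \<open>X\<^sub>s\<close> has no exponential moment beyond \<open>b\<close>. The drift is the first moment of \<open>a/(c+1) l\<close> on \<open>(0,1)\<close>, computed by means of
  the antiderivative \<open>x\<^sup>2 l x / 2 - (c+1)/2 b powr (c-1) \<Gamma>(1-c, b x)\<close> of \<open>x l x\<close>.
\<close>

section \<open>Incomplete Gamma functions and Laplace integrals\<close>

text \<open>The factor \<open>u\<close> is there because u times the integral of \<phi>(u y) over y
  in (0,1) is a primitive of \<phi>. Both sides can then be compared by differentiating on a convex
  open half-plane and evaluating at u = 0, with no branch of a logarithm to follow and no division
  by u. The obstacle is the quantifier over all u with a well-defined transform. The hypothesis on X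
  speaks only of Re u > -b, whereas the transform of the average exists on the closed half-plane.
  That set must be found exactly, since the continuous logarithm is taken on it and owes its
  uniqueness to the connectedness of that set. Hence the two limiting arguments: monotone
  convergence reaches the boundary line, and the infinite slope of h powr c at 0 excludes everything
  beyond it.\<close>

lemma set_integral_FTC_greaterThan:
  fixes f F :: "real \<Rightarrow> 'a::euclidean_space"
  assumes "\<And>x. a < x \<Longrightarrow> (F has_vector_derivative f x) (at x)"
    and "\<And>x. a < x \<Longrightarrow> isCont f x"
    and "set_integrable lborel {a<..} f"
    and "(F \<longlongrightarrow> A) (at_right a)"
    and "(F \<longlongrightarrow> B) at_top"
  shows "(LBINT x:{a<..}. f x) = B - A"
proof -
  have "(LBINT x=ereal a..\<infinity>. f x) = B - A"
  proof (rule interval_integral_FTC_integrable[where F = F])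
    show "((F \<circ> real_of_ereal) \<longlongrightarrow> A) (at_right (ereal a))"
      using assms(4) by (simp add: ereal_tendsto_simps1)
    show "((F \<circ> real_of_ereal) \<longlongrightarrow> B) (at_left \<infinity>)"
      using assms(5) by (simp add: ereal_tendsto_simps1)
  qed (use assms in auto)
  then show ?thesis
    by (simp add: interval_integral_to_infinity_eq)
qed

lemma set_integral_FTC_greaterThanLessThan:
  fixes f F :: "real \<Rightarrow> 'a::euclidean_space"
  assumes "a < b"
    and "\<And>x. a < x \<Longrightarrow> x < b \<Longrightarrow> (F has_vector_derivative f x) (at x)"
    and "\<And>x. a < x \<Longrightarrow> x < b \<Longrightarrow> isCont f x"
    and "set_integrable lborel {a<..<b} f"
    and "(F \<longlongrightarrow> A) (at_right a)"
    and "(F \<longlongrightarrow> B) (at_left b)"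
  shows "(LBINT x:{a<..<b}. f x) = B - A"
proof -
  have "(LBINT x=ereal a..ereal b. f x) = B - A"
  proof (rule interval_integral_FTC_integrable[where F = F])
    show "((F \<circ> real_of_ereal) \<longlongrightarrow> A) (at_right (ereal a))"
      using assms(5) by (simp add: ereal_tendsto_simps1)
    show "((F \<circ> real_of_ereal) \<longlongrightarrow> B) (at_left (ereal b))"
      using assms(6) by (simp add: ereal_tendsto_simps1)
  qed (use assms in auto)
  then show ?thesis
    using \<open>a < b\<close> by (simp add: interval_lebesgue_integral_def)
qed

lemma set_integrable_powr_exp:
  fixes p e :: real
  assumes "p > -1" "e > 0"
  shows "set_integrable lborel {0<..} (\<lambda>x. x powr p * exp (- e * x))"
proof -
  have "set_integrable lebesgue {0<..} (\<lambda>x. complex_of_real x powr (of_real (p + 1) - 1) / of_real (exp (e * x)))"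
    using absolutely_integrable_Gamma_integral[of "of_real (p + 1)" e] assms by simp
  then have "set_integrable lebesgue {0<..}
      (\<lambda>x. norm (complex_of_real x powr (of_real (p + 1) - 1) / of_real (exp (e * x))))"
    by (rule set_integrable_norm)
  also have "?this \<longleftrightarrow> set_integrable lebesgue {0<..} (\<lambda>x. x powr p * exp (- e * x))"
    by (intro set_integrable_cong)
       (auto simp: norm_divide norm_powr_real_powr exp_minus field_simps)
  \<comment> \<open>Since \<open>lebesgue\<close> is the completion of \<open>lborel\<close> and the
    integrand is Borel, integrability descends.\<close>
  finally show ?thesis
    unfolding set_integrable_def
    by (subst (asm) integrable_completion) auto
qed

lemma upper_Gamma_set_integrable:
  fixes s y :: real
  assumes "0 < y"
  shows "set_integrable lborel {y..} (\<lambda>z. z powr (s - 1) * exp (- z))"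
proof -
  \<comment> \<open>This splits the exponent as (s - 1 - q) + q. The first part is at most 0, so its
    power is bounded on {y..} by the value at \<open>y\<close>; the second is nonnegative and leaves
    a Gamma integrand. Negative \<open>s\<close> is thereby covered.\<close>
  define q where "q = max (s - 1) 0"
  have "set_integrable lborel {0<..} (\<lambda>x. x powr q * exp (- 1 * x))"
    by (intro set_integrable_powr_exp) (auto simp: q_def)
  then have "set_integrable lborel {y..} (\<lambda>x. x powr q * exp (- 1 * x))"
    by (rule set_integrable_subset) (use assms in auto)
  then have *: "set_integrable lborel {y..} (\<lambda>x. y powr (s - 1 - q) * (x powr q * exp (- 1 * x)))"
    by simp
  show ?thesis
  proof (rule set_integrable_bound[OF *])
    show "set_borel_measurable lborel {y..} (\<lambda>z. z powr (s - 1) * exp (- z))"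
      unfolding set_borel_measurable_def by measurable
    show "AE z in lborel. z \<in> {y..} \<longrightarrow> norm (z powr (s - 1) * exp (- z))
        \<le> norm (y powr (s - 1 - q) * (z powr q * exp (- 1 * z)))"
    proof (intro AE_I2 impI)
      fix z assume "z \<in> {y..}"
      then have z: "y \<le> z" by simp
      have "z powr (s - 1) = z powr (s - 1 - q) * z powr q"
        using z assms by (simp add: powr_add[symmetric])
      also have "\<dots> \<le> y powr (s - 1 - q) * z powr q"
        using z assms by (intro mult_right_mono powr_mono2') (auto simp: q_def)
      finally show "norm (z powr (s - 1) * exp (- z))
        \<le> norm (y powr (s - 1 - q) * (z powr q * exp (- 1 * z)))"
        by (simp add: mult.assoc[symmetric])
    qed
  qed
qed

lemma upper_Gamma_nonneg: "0 \<le> upper_Gamma s y"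
  unfolding upper_Gamma_def set_lebesgue_integral_def by (intro integral_nonneg_AE) auto

lemma set_integral_Ioi_eq_Ici:
  fixes f :: "real \<Rightarrow> 'a::{banach, second_countable_topology}"
  shows "(LBINT x:{a<..}. f x) = (LBINT x:{a..}. f x)"
  unfolding set_lebesgue_integral_def
proof (cases "(\<lambda>x. indicator {a..} x *\<^sub>R f x) \<in> borel_measurable lborel")
  case True
  have *: "(\<lambda>x. indicator {a<..} x *\<^sub>R f x) = (\<lambda>x. indicator {a<..} x *\<^sub>R (indicator {a..} x *\<^sub>R f x))"
    by (auto simp: indicator_def)
  show "(LBINT x. indicator {a<..} x *\<^sub>R f x) = (LBINT x. indicator {a..} x *\<^sub>R f x)"
  proof (rule integral_cong_AE)
    show "(\<lambda>x. indicator {a<..} x *\<^sub>R f x) \<in> borel_measurable lborel"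
      unfolding * by (intro borel_measurable_scaleR True) auto
    show "AE x in lborel. indicator {a<..} x *\<^sub>R f x = indicator {a..} x *\<^sub>R f x"
      using AE_lborel_singleton[of a] by eventually_elim (auto simp: indicator_def)
  qed fact
next
  \<comment> \<open>Both sides take the default value 0: the indicators differ only at the point
    \<open>a\<close>, so a failure of measurability on one ray carries over to the other.\<close>
  case False
  have "(\<lambda>x. indicator {a<..} x *\<^sub>R f x) \<notin> borel_measurable lborel"
  proof
    assume m: "(\<lambda>x. indicator {a<..} x *\<^sub>R f x) \<in> borel_measurable lborel"
    have "(\<lambda>x. indicator {a<..} x *\<^sub>R f x + indicator {a} x *\<^sub>R f a) \<in> borel_measurable lborel"
      by (intro borel_measurable_add m) auto
    also have "(\<lambda>x. indicator {a<..} x *\<^sub>R f x + indicator {a} x *\<^sub>R f a) = (\<lambda>x. indicator {a..} x *\<^sub>R f x)"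
      by (auto simp: indicator_def fun_eq_iff)
    finally show False using False by simp
  qed
  then have "(LBINT x. indicator {a<..} x *\<^sub>R f x) = 0"
    by (intro not_integrable_integral_eq notI) (drule borel_measurable_integrable, erule notE)
  moreover have "(LBINT x. indicator {a..} x *\<^sub>R f x) = 0"
    using False by (intro not_integrable_integral_eq notI) (drule borel_measurable_integrable, erule notE)
  ultimately show "(LBINT x. indicator {a<..} x *\<^sub>R f x) = (LBINT x. indicator {a..} x *\<^sub>R f x)"
    by simp
qed

lemma upper_Gamma_eq: "upper_Gamma s y = (LBINT z:{y<..}. z powr (s - 1) * exp (- z))"
  by (simp add: upper_Gamma_def set_integral_Ioi_eq_Ici)

text \<open>For \<open>s \<le> 1\<close> the power is nonincreasing and can be frozen at the lower
  limit. With \<open>s = -c\<close> and argument \<open>b * x\<close> this bound yields the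
  nonnegativity of the averaged density.\<close>

lemma upper_Gamma_le:
  fixes s y :: real
  assumes "0 < y" "s \<le> 1"
  shows "upper_Gamma s y \<le> y powr (s - 1) * exp (- y)"
proof -
  have "set_integrable lborel {y..} (\<lambda>z. z powr (1 - 1) * exp (- z)) \<longleftrightarrow>
      set_integrable lborel {y..} (\<lambda>z. exp (- z))"
    by (rule set_integrable_cong) (use assms in auto)
  with upper_Gamma_set_integrable[OF \<open>0 < y\<close>, of 1]
  have int1: "set_integrable lborel {y..} (\<lambda>z. exp (- z))" by simp
  have e: "(LBINT z:{y<..}. exp (- z)) = 0 - (- exp (- y))"
  proof (rule set_integral_FTC_greaterThan)
    show "((\<lambda>z. - exp (- z)) has_vector_derivative exp (- x)) (at x)" for x :: real
      by (auto intro!: derivative_eq_intros simp flip: has_real_derivative_iff_has_vector_derivative)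
    show "set_integrable lborel {y<..} (\<lambda>z. exp (- z))"
      by (rule set_integrable_subset[OF int1]) auto
    show "((\<lambda>z. - exp (- z)) \<longlongrightarrow> - exp (- y)) (at_right y)"
      by (intro tendsto_intros)
    show "((\<lambda>z::real. - exp (- z)) \<longlongrightarrow> 0) at_top"
      by real_asymp
  qed auto
  have "upper_Gamma s y \<le> (LBINT z:{y..}. y powr (s - 1) * exp (- z))"
    unfolding upper_Gamma_def
    using assms by (intro set_integral_mono upper_Gamma_set_integrable int1 set_integrable_mult_right)
       (auto intro!: mult_right_mono powr_mono2')
  also have "\<dots> = y powr (s - 1) * (LBINT z:{y..}. exp (- z))" 
    by simp
  also have "(LBINT z:{y..}. exp (- z)) = exp (- y)"
    using e by (simp add: set_integral_Ioi_eq_Ici)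
  finally show ?thesis .
qed

lemma has_real_derivative_upper_Gamma:
  fixes s y :: real
  assumes "0 < y"
  shows "(upper_Gamma s has_real_derivative - (y powr (s - 1) * exp (- y))) (at y)"
proof -
  define g where "g = (\<lambda>z::real. z powr (s - 1) * exp (- z))"
  \<comment> \<open>A base point strictly between 0 and \<open>y\<close> moves the variable limit
    into an integral over a compact interval on which \<open>g\<close> is continuous; the full tail
    from \<open>y0\<close> is a constant.\<close>
  define y0 where "y0 = y / 2"
  have y0: "0 < y0" "y0 < y" using assms by (auto simp: y0_def)
  have cont: "continuous_on {y0..2 * y} g"
    unfolding g_def using y0 by (intro continuous_intros) auto
  have split: "upper_Gamma s x = upper_Gamma s y0 - integral {y0..x} g" if "y0 \<le> x" for x
  proof -
    have int0: "set_integrable lborel {y0..} g"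
      unfolding g_def by (intro upper_Gamma_set_integrable y0)
    have int1: "set_integrable lborel {y0..x} g" and int2: "set_integrable lborel {x<..} g"
      by (rule set_integrable_subset[OF int0], use that in auto)+
    have "upper_Gamma s y0 = (LBINT z:{y0..x} \<union> {x<..}. g z)"
      using that by (simp add: upper_Gamma_def g_def ivl_disj_un)
    also have "\<dots> = (LBINT z:{y0..x}. g z) + (LBINT z:{x<..}. g z)"
      by (intro set_integral_Un int1 int2) auto
    also have "(LBINT z:{y0..x}. g z) = integral {y0..x} g"
      using int1 by (rule set_borel_integral_eq_integral)
    also have "(LBINT z:{x<..}. g z) = upper_Gamma s x"
      by (simp add: upper_Gamma_eq g_def)
    finally show ?thesis by simp
  qed
  have "((\<lambda>x. integral {y0..x} g) has_real_derivative g y) (at y within {y0..2 * y})"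
    by (rule integral_has_real_derivative[OF cont]) (use y0 assms in auto)
  then have "((\<lambda>x. integral {y0..x} g) has_real_derivative g y) (at y)"
    using y0 assms by (subst (asm) at_within_interior) auto
  then have "((\<lambda>x. upper_Gamma s y0 - integral {y0..x} g) has_real_derivative - g y) (at y)"
    by (auto intro!: derivative_eq_intros)
  then have "(upper_Gamma s has_real_derivative - g y) (at y)"
  proof (rule has_field_derivative_transform_within_open)
    show "upper_Gamma s y0 - integral {y0..x} g = upper_Gamma s x" if "x \<in> {y0<..}" for x
      by (rule split[symmetric]) (use that in simp)
  qed (use y0 in auto)
  then show ?thesis by (simp add: g_def)
qed

lemma powr_exp_tendsto_0_at_top:
  fixes p e :: real
  assumes "0 < e"
  shows "((\<lambda>x. x powr p * exp (- e * x)) \<longlongrightarrow> 0) at_top"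
  using assms by real_asymp

text \<open>Integration by parts: \<open>s * g - f\<close> is the derivative of \<open>f\<close>. At
  \<open>s = 1 - c\<close> it later trades the \<open>exp (- b)\<close> in the drift for
  \<open>upper_Gamma (2 - c) b\<close>.\<close>

lemma upper_Gamma_plus1:
  fixes s y :: real
  assumes "0 < y"
  shows "upper_Gamma (s + 1) y = s * upper_Gamma s y + y powr s * exp (- y)"
proof -
  define f where "f = (\<lambda>z::real. z powr s * exp (- z))"
  define g where "g = (\<lambda>z::real. z powr (s - 1) * exp (- z))"
  have f: "set_integrable lborel {y<..} f" and g: "set_integrable lborel {y<..} g"
    using upper_Gamma_set_integrable[OF assms, of "s + 1"] upper_Gamma_set_integrable[OF assms, of s]
    unfolding f_def g_def by (auto intro: set_integrable_subset)
  have "(LBINT z:{y<..}. s * g z - f z) = 0 - f y"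
  proof (rule set_integral_FTC_greaterThan[where F = f])
    fix x assume "y < x"
    then have x: "0 < x" using assms by simp
    show "(f has_vector_derivative (s * g x - f x)) (at x)"
      unfolding f_def g_def has_real_derivative_iff_has_vector_derivative [symmetric]
      using x by (auto intro!: derivative_eq_intros simp: powr_diff field_simps)
    show "isCont (\<lambda>z. s * g z - f z) x"
      unfolding f_def g_def using x by (intro continuous_intros) auto
  next
    show "set_integrable lborel {y<..} (\<lambda>z. s * g z - f z)"
      by (intro set_integral_diff set_integrable_mult_right f g)
    show "(f \<longlongrightarrow> f y) (at_right y)"
      unfolding f_def using assms by (intro tendsto_intros) auto
    show "(f \<longlongrightarrow> 0) at_top"
      using powr_exp_tendsto_0_at_top[of 1 s] by (simp add: f_def)
  qed
  also have "(LBINT z:{y<..}. s * g z - f z) = s * (LBINT z:{y<..}. g z) - (LBINT z:{y<..}. f z)"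
    using f g by (subst set_integral_diff) auto
  finally show ?thesis
    by (simp add: upper_Gamma_eq f_def g_def)
qed

lemma Gamma_conv_set_integral:
  fixes s :: real
  assumes "0 < s"
  shows "Gamma s = (LBINT z:{0<..}. z powr (s - 1) * exp (- z))"
proof -
  have int: "set_integrable lborel {0<..} (\<lambda>z. z powr (s - 1) * exp (- z))"
    using set_integrable_powr_exp[of "s - 1" 1] assms by simp
  have "((\<lambda>t. t powr (s - 1) * exp (- t)) has_integral Gamma s) {0..}"
    using Gamma_integral_real[OF assms] by (simp add: exp_minus field_simps)
  then have "((\<lambda>t. t powr (s - 1) * exp (- t)) has_integral Gamma s) {0<..}"
    by (subst (asm) has_integral_spike_set_eq[of _ "{0<..}"]) (auto intro: negligible_subset[of "{0}"])
  with set_borel_integral_eq_integral(2)[OF int] show ?thesis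
    by (simp add: integral_unique)
qed

text \<open>Dominated convergence, with the Gamma integrand itself as the majorant of its
  truncations. The case \<open>s = 1 - c\<close> supplies the complete Gamma value in the
  drift.\<close>

lemma upper_Gamma_tendsto_Gamma:
  fixes s :: real
  assumes "0 < s"
  shows "(upper_Gamma s \<longlongrightarrow> Gamma s) (at_right 0)"
  unfolding tendsto_at_iff_sequentially
proof (intro allI impI)
  fix Y :: "nat \<Rightarrow> real"
  assume Y: "\<forall>i. Y i \<in> {0<..} - {0}" and lim: "Y \<longlonglongrightarrow> 0"
  define g where "g = (\<lambda>z::real. z powr (s - 1) * exp (- z))"
  have int: "integrable lborel (\<lambda>z. indicator {0<..} z *\<^sub>R g z)"
    using set_integrable_powr_exp[of "s - 1" 1] assms by (simp add: g_def set_integrable_def)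
  have "(\<lambda>i. LBINT z. indicator {Y i<..} z *\<^sub>R g z) \<longlonglongrightarrow> (LBINT z. indicator {0<..} z *\<^sub>R g z)"
  proof (rule integral_dominated_convergence[OF _ _ int])
    show "AE z in lborel. (\<lambda>i. indicator {Y i<..} z *\<^sub>R g z) \<longlonglongrightarrow> indicator {0<..} z *\<^sub>R g z"
    proof (rule AE_I2)
      fix z :: real
      show "(\<lambda>i. indicator {Y i<..} z *\<^sub>R g z) \<longlonglongrightarrow> indicator {0<..} z *\<^sub>R g z"
      proof (cases "0 < z")
        case True
        then have "eventually (\<lambda>i. Y i < z) sequentially"
          using order_tendstoD(2)[OF lim] by simp
        then have "eventually (\<lambda>i. indicator {Y i<..} z *\<^sub>R g z = indicator {0<..} z *\<^sub>R g z) sequentially"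
          by eventually_elim (use True in auto)
        then show ?thesis by (rule tendsto_eventually)
      next
        case False
        then have "indicator {Y i<..} z = (0::real)" for i
          using Y[rule_format, of i] by (auto simp: indicator_def)
        with False show ?thesis by simp
      qed
    qed
    show "AE z in lborel. norm (indicator {Y i<..} z *\<^sub>R g z) \<le> indicator {0<..} z *\<^sub>R g z" for i
      using Y[rule_format, of i] by (auto simp: indicator_def g_def)
  qed (auto simp: g_def)
  then show "(upper_Gamma s \<circ> Y) \<longlonglongrightarrow> Gamma s"
    using assms by (simp add: comp_def upper_Gamma_eq Gamma_conv_set_integral g_def set_lebesgue_integral_def)
qed

section \<open>Differentiation of Laplace integrals and the Gamma integral with complex
  scale\<close>

lemma norm_exp_minus_1_le:
  fixes z :: complex
  shows "norm (exp z - 1) \<le> norm z * max 1 (exp (Re z))"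
proof -
  have "norm (exp z - exp 0) \<le> max 1 (exp (Re z)) * norm (z - 0)"
  proof (rule field_differentiable_bound[where S = "closed_segment 0 z"])
    fix w assume "w \<in> closed_segment 0 z"
    then obtain r where r: "0 \<le> r" "r \<le> 1" "w = of_real r * z"
      by (auto simp: in_segment scaleR_conv_of_real)
    \<comment> \<open>Along the segment from 0 to \<open>z\<close> the modulus of exp runs
      monotonically from 1 to exp (Re z); the maximum covers either sign of Re z.\<close>
    have "exp (r * Re z) \<le> max 1 (exp (Re z))"
    proof (cases "Re z \<le> 0")
      case True
      then have "r * Re z \<le> 0" using r by (simp add: mult_nonneg_nonpos)
      then show ?thesis by (simp add: le_max_iff_disj)
    next
      case False
      then have "r * Re z \<le> Re z" using r by (simp add: mult_left_le_one_le)
      then show ?thesis by (simp add: le_max_iff_disj)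
    qed
    then show "norm (exp w) \<le> max 1 (exp (Re z))"
      using r by simp
    show "(exp has_field_derivative exp w) (at w within closed_segment 0 z)"
      by (intro DERIV_exp[THEN has_field_derivative_at_within])
  qed auto
  then show ?thesis by (simp add: mult.commute)
qed

text \<open>The constant \<open>\<kappa>\<close> compensates a possible singularity of \<open>g\<close> at 0.\<close>

lemma has_field_derivative_Laplace_integral:
  fixes g :: "real \<Rightarrow> real" and \<kappa> u :: complex and \<sigma> :: real
  assumes int: "\<And>u. \<sigma> < Re u \<Longrightarrow>
      set_integrable lborel {0<..} (\<lambda>x. (exp (- u * of_real x) - \<kappa>) * of_real (g x))"
    and int': "\<And>r. \<sigma> < r \<Longrightarrow> set_integrable lborel {0<..} (\<lambda>x. x * g x * exp (- r * x))"
    and u: "\<sigma> < Re u"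
  shows "((\<lambda>u. LBINT x:{0<..}. (exp (- u * of_real x) - \<kappa>) * of_real (g x)) has_field_derivative
      - (LBINT x:{0<..}. exp (- u * of_real x) * of_real (x * g x))) (at u)"
proof -
  \<comment> \<open>Half the distance to the boundary: difference quotients may grow by an extra
    factor exp (\<delta> x), and \<open>int'\<close> still applies at Re u - \<delta>.\<close>
  define \<delta> where "\<delta> = (Re u - \<sigma>) / 2"
  have \<delta>: "0 < \<delta>" "\<sigma> < Re u - \<delta>" using u by (auto simp: \<delta>_def field_simps)
  define G where "G = (\<lambda>u::complex. LBINT x:{0<..}. (exp (- u * of_real x) - \<kappa>) * of_real (g x))"
  define D where "D = - (LBINT x:{0<..}. exp (- u * of_real x) * of_real (x * g x))"
  have "((\<lambda>h. (G (u + h) - G u) / h) \<longlongrightarrow> D) (at 0)"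
    unfolding tendsto_at_iff_sequentially
  proof (intro allI impI)
    fix h :: "nat \<Rightarrow> complex"
    assume h0: "\<forall>i. h i \<in> UNIV - {0}" and lim: "h \<longlonglongrightarrow> 0"
    from lim \<delta> have "eventually (\<lambda>i. norm (h i) < \<delta>) sequentially"
      by (intro order_tendstoD[OF tendsto_norm_zero])
    then obtain N where N: "\<And>i. N \<le> i \<Longrightarrow> norm (h i) < \<delta>"
      by (auto simp: eventually_sequentially)
    \<comment> \<open>Dropping finitely many terms makes the bound by \<delta> valid for every
      index, as the dominated convergence theorem asks; \<open>LIMSEQ_offset\<close> restores
      them.\<close>
    define k where "k = (\<lambda>i. h (i + N))"
    have k: "norm (k i) < \<delta>" "k i \<noteq> 0" for i
      using N h0 by (auto simp: k_def)
    have klim: "k \<longlonglongrightarrow> 0" unfolding k_def using lim by (rule LIMSEQ_ignore_initial_segment)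
    define q where "q = (\<lambda>i x. indicator {0<..} x *\<^sub>R
       (((exp (- (u + k i) * of_real x) - \<kappa>) * of_real (g x) - (exp (- u * of_real x) - \<kappa>) * of_real (g x)) / k i))"
    have reu: "\<sigma> < Re (u + k i)" for i
      using k[of i] abs_Re_le_cmod[of "k i"] \<delta> by simp
    have q_diff: "q i = (\<lambda>x. (indicator {0<..} x *\<^sub>R ((exp (- (u + k i) * of_real x) - \<kappa>) * of_real (g x))
        - indicator {0<..} x *\<^sub>R ((exp (- u * of_real x) - \<kappa>) * of_real (g x))) / k i)" for i
      by (simp add: q_def scaleR_conv_of_real right_diff_distrib diff_divide_distrib)
    have quot: "(G (u + k i) - G u) / k i = (LBINT x. q i x)" for i
      unfolding G_def q_diff using int[OF reu[of i]] int[OF u]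
      by (simp only: set_lebesgue_integral_def set_integrable_def integral_divide_zero Bochner_Integration.integral_diff)
    have qint: "integrable lborel (q i)" for i
      using int[OF reu[of i]] int[OF u] unfolding q_diff set_integrable_def
      by (intro integrable_divide_zero Bochner_Integration.integrable_diff)
    have w: "integrable lborel (\<lambda>x. indicator {0<..} x *\<^sub>R \<bar>x * g x * exp (- (Re u - \<delta>) * x)\<bar>)"
      using set_integrable_norm[OF int'[OF \<delta>(2)]] by (simp add: set_integrable_def)
    \<comment> \<open>Measurability of the limit function is read off from \<open>int'\<close>:
      multiplying by exp (Re u x) removes the damping.\<close>
    have m0: "(\<lambda>x. indicator {0<..} x *\<^sub>R (x * g x * exp (- Re u * x))) \<in> borel_measurable lborel"
      using int'[OF u] unfolding set_integrable_def by (rule borel_measurable_integrable)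
    have "(\<lambda>x. - (exp (- u * of_real x) * of_real (exp (Re u * x)) *
        complex_of_real (indicator {0<..} x *\<^sub>R (x * g x * exp (- Re u * x))))) \<in> borel_measurable lborel"
      using measurable_compose[OF m0 borel_measurable_of_real] by measurable
    also have "(\<lambda>x. - (exp (- u * of_real x) * of_real (exp (Re u * x)) *
        complex_of_real (indicator {0<..} x *\<^sub>R (x * g x * exp (- Re u * x)))))
        = (\<lambda>x. - (indicator {0<..} x *\<^sub>R (exp (- u * of_real x) * of_real (x * g x))))"
      by (auto simp: fun_eq_iff indicator_def exp_minus)
    finally have meas: "(\<lambda>x. - (indicator {0<..} x *\<^sub>R (exp (- u * of_real x) * of_real (x * g x))))
       \<in> borel_measurable lborel" .
    \<comment> \<open>The constant \<kappa> cancels. What remains is a quotient of order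
      \<open>x\<close>, which is why \<open>int'\<close> carries the weight
      \<open>x * g x\<close>.\<close>
    have q_eq: "q i x = indicator {0<..} x *\<^sub>R (exp (- u * of_real x) * of_real (g x) *
        ((exp (- (k i * of_real x)) - 1) / k i))" for i x
      unfolding q_def by (simp add: exp_add [symmetric] algebra_simps diff_divide_distrib flip: exp_add)
    have "(\<lambda>i. LBINT x. q i x) \<longlonglongrightarrow> (LBINT x. - (indicator {0<..} x *\<^sub>R (exp (- u * of_real x) * of_real (x * g x))))"
    proof (rule integral_dominated_convergence[OF meas _ w])
      show "q i \<in> borel_measurable lborel" for i using qint by auto
      show "AE x in lborel. (\<lambda>i. q i x) \<longlonglongrightarrow> - (indicator {0<..} x *\<^sub>R (exp (- u * of_real x) * of_real (x * g x)))"
      proof (rule AE_I2)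
        fix x :: real
        have "((\<lambda>w. exp (- (w * of_real x))) has_field_derivative - of_real x) (at (0::complex))"
          by (auto intro!: derivative_eq_intros)
        then have "((\<lambda>w. (exp (- (w * of_real x)) - 1) / w) \<longlongrightarrow> - of_real x) (at (0::complex))"
          by (simp add: DERIV_def)
        then have "(\<lambda>i. (exp (- (k i * of_real x)) - 1) / k i) \<longlonglongrightarrow> - of_real x"
          using klim k unfolding tendsto_at_iff_sequentially comp_def by auto
        then have "(\<lambda>i. q i x) \<longlonglongrightarrow> indicator {0<..} x *\<^sub>R (exp (- u * of_real x) * of_real (g x) * (- of_real x))"
          unfolding q_eq by (intro tendsto_intros)
        then show "(\<lambda>i. q i x) \<longlonglongrightarrow> - (indicator {0<..} x *\<^sub>R (exp (- u * of_real x) * of_real (x * g x)))"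
          by (simp add: mult_ac)
      qed
      show "AE x in lborel. norm (q i x) \<le> indicator {0<..} x *\<^sub>R \<bar>x * g x * exp (- (Re u - \<delta>) * x)\<bar>" for i
      proof (rule AE_I2)
        fix x :: real
        show "norm (q i x) \<le> indicator {0<..} x *\<^sub>R \<bar>x * g x * exp (- (Re u - \<delta>) * x)\<bar>"
        proof (cases "0 < x")
          case True
          have "Re (- (k i * of_real x)) \<le> \<delta> * x"
            using mult_right_mono[of "- Re (k i)" \<delta> x] k[of i] abs_Re_le_cmod[of "k i"] True by simp
          then have m: "max 1 (exp (Re (- (k i * of_real x)))) \<le> exp (\<delta> * x)"
            using True \<delta> by simp
          have "norm (exp (- (k i * of_real x)) - 1) \<le> norm (k i) * x * exp (\<delta> * x)"
            using order_trans[OF norm_exp_minus_1_le mult_left_mono[OF m norm_ge_zero]] True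
            by (simp add: norm_mult)
          then have "norm ((exp (- (k i * of_real x)) - 1) / k i) \<le> x * exp (\<delta> * x)"
            using k[of i] by (simp add: norm_divide field_simps)
          then have "norm (q i x) \<le> exp (- Re u * x) * \<bar>g x\<bar> * (x * exp (\<delta> * x))"
            using True unfolding q_eq
            by (simp add: norm_mult mult_left_mono del: times_divide_eq_right)
          also have "\<dots> = \<bar>x * g x * exp (- (Re u - \<delta>) * x)\<bar>"
          proof -
            have "exp (- (Re u - \<delta>) * x) = exp (- Re u * x) * exp (\<delta> * x)"
              by (simp add: algebra_simps flip: exp_add)
            then show ?thesis using True by (simp only: abs_mult) simp
          qed
          finally show ?thesis using True by simp
        qed (simp add: q_eq)
      qed
    qed
    then have "(\<lambda>i. (G (u + k i) - G u) / k i) \<longlonglongrightarrow> D"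
      unfolding quot D_def set_lebesgue_integral_def by simp
    then have "(\<lambda>i. (G (u + h (i + N)) - G u) / h (i + N)) \<longlonglongrightarrow> D"
      by (simp add: k_def)
    then show "((\<lambda>h. (G (u + h) - G u) / h) \<circ> h) \<longlonglongrightarrow> D"
      unfolding comp_def by (rule LIMSEQ_offset)
  qed
  then show ?thesis unfolding G_def D_def DERIV_def .
qed

lemma set_integrable_exp_powr_complex:
  fixes w :: complex and p :: real
  assumes "p > -1" "Re w > 0"
  shows "set_integrable lborel {0<..} (\<lambda>x. exp (- w * of_real x) * of_real (x powr p))"
proof (rule set_integrable_bound[OF set_integrable_powr_exp[OF assms]])
  show "set_borel_measurable lborel {0<..} (\<lambda>x. exp (- w * of_real x) * complex_of_real (x powr p))"
    unfolding set_borel_measurable_def by measurable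
qed (auto simp: norm_mult)

text \<open>A substitution for real \<open>w\<close>; for complex \<open>w\<close> it would be a
  rotation of the contour. Instead, \<open>K (s - 1)\<close> has the derivative \<open>- K s\<close>
  in \<open>w\<close>, and integration by parts gives \<open>s * K (s - 1) w = w * K s w\<close>.
  Hence \<open>w powr s * K (s - 1) w\<close> has derivative zero on the right half-plane, and its
  constant value is read off at \<open>w = 1\<close>.\<close>

lemma Gamma_integral_scaled_complex:
  fixes w :: complex and s :: real
  assumes s: "s > 0" and w: "Re w > 0"
  shows "(LBINT x:{0<..}. exp (- w * of_real x) * of_real (x powr (s - 1))) = of_real (Gamma s) * w powr (- of_real s)"
proof -
  define K where "K = (\<lambda>p (w::complex). LBINT x:{0<..}. exp (- w * of_real x) * of_real (x powr p))"
  have K': "(K (s - 1) has_field_derivative - K s w) (at w)" if "Re w > 0" for w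
  proof -
    have "((\<lambda>w. LBINT x:{0<..}. (exp (- w * of_real x) - 0) * of_real (x powr (s - 1))) has_field_derivative
        - (LBINT x:{0<..}. exp (- w * of_real x) * of_real (x * x powr (s - 1)))) (at w)"
    proof (rule has_field_derivative_Laplace_integral[where \<sigma> = 0])
      show "set_integrable lborel {0<..} (\<lambda>x. (exp (- u * complex_of_real x) - 0) * complex_of_real (x powr (s - 1)))"
        if "0 < Re u" for u
        using set_integrable_exp_powr_complex[of "s - 1" u] s that by simp
      show "set_integrable lborel {0<..} (\<lambda>x. x * x powr (s - 1) * exp (- r * x))" if "0 < r" for r
      proof -
        have "set_integrable lborel {0<..} (\<lambda>x. x powr s * exp (- r * x))"
          using s that by (intro set_integrable_powr_exp) auto
        also have "?this \<longleftrightarrow> ?thesis"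
          by (intro set_integrable_cong) (auto simp: powr_diff)
        finally show ?thesis .
      qed
    qed (use that in auto)
    also have "(LBINT x:{0<..}. exp (- w * of_real x) * of_real (x * x powr (s - 1))) = K s w"
      unfolding K_def by (intro set_lebesgue_integral_cong) (auto simp: powr_diff)
    finally show ?thesis by (simp add: K_def)
  qed
  have rec: "of_real s * K (s - 1) w = w * K s w" if "Re w > 0" for w
  proof -
    have int: "set_integrable lborel {0<..} (\<lambda>x. exp (- w * of_real x) * complex_of_real (x powr (s - 1)))"
      "set_integrable lborel {0<..} (\<lambda>x. exp (- w * of_real x) * complex_of_real (x powr s))"
      using set_integrable_exp_powr_complex[of "s - 1" w] set_integrable_exp_powr_complex[of s w] s that
      by simp_all
    have "(LBINT x:{0<..}. of_real s * (exp (- w * of_real x) * of_real (x powr (s - 1))) -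
        w * (exp (- w * of_real x) * of_real (x powr s))) = 0 - 0"
    proof (rule set_integral_FTC_greaterThan)
      fix x :: real assume x: "0 < x"
      have "((\<lambda>x. complex_of_real (x powr s)) has_vector_derivative of_real (s * x powr (s - 1))) (at x)"
        using x by (intro has_vector_derivative_of_real)
          (auto intro!: derivative_eq_intros simp: powr_diff simp flip: has_real_derivative_iff_has_vector_derivative)
      moreover have "((\<lambda>x. exp (- w * complex_of_real x)) has_vector_derivative - w * exp (- w * of_real x)) (at x)"
        by (rule has_vector_derivative_real_field) (auto intro!: derivative_eq_intros)
      ultimately have "((\<lambda>x. exp (- w * complex_of_real x) * of_real (x powr s)) has_vector_derivative
        exp (- w * of_real x) * of_real (s * x powr (s - 1)) +
        (- w * exp (- w * of_real x)) * of_real (x powr s)) (at x)"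
        by (intro has_vector_derivative_mult)
      then show "((\<lambda>x. exp (- w * complex_of_real x) * of_real (x powr s)) has_vector_derivative
        of_real s * (exp (- w * of_real x) * of_real (x powr (s - 1))) -
        w * (exp (- w * of_real x) * of_real (x powr s))) (at x)"
        by (simp add: algebra_simps)
      show "isCont (\<lambda>x. of_real s * (exp (- w * of_real x) * of_real (x powr (s - 1))) -
        w * (exp (- w * of_real x) * of_real (x powr s))) x"
        using x by (intro continuous_intros) auto
    next
      show "set_integrable lborel {0<..} (\<lambda>x. of_real s * (exp (- w * of_real x) * of_real (x powr (s - 1))) -
        w * (exp (- w * of_real x) * of_real (x powr s)))"
        by (intro set_integral_diff set_integrable_mult_right int)
      show "((\<lambda>x. exp (- w * complex_of_real x) * of_real (x powr s)) \<longlongrightarrow> 0) (at_right 0)"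
      proof (rule tendsto_norm_zero_cancel)
        define e where "e = Re w"
        have "((\<lambda>x. exp (- e * x) * (x powr s)) \<longlongrightarrow> 0) (at_right 0)"
          using s by real_asymp
        moreover have "eventually (\<lambda>x. exp (- e * x) * (x powr s) = 
            norm (exp (- w * complex_of_real x) * of_real (x powr s))) (at_right 0)"
          by (auto simp: norm_mult e_def)
        ultimately show "((\<lambda>x. norm (exp (- w * complex_of_real x) * of_real (x powr s))) \<longlongrightarrow> 0) (at_right 0)"
          by (rule Lim_transform_eventually)
      qed
      show "((\<lambda>x. exp (- w * complex_of_real x) * of_real (x powr s)) \<longlongrightarrow> 0) at_top"
      proof (rule tendsto_norm_zero_cancel)
        show "((\<lambda>x. norm (exp (- w * complex_of_real x) * of_real (x powr s))) \<longlongrightarrow> 0) at_top"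
          using powr_exp_tendsto_0_at_top[OF that, of s] by (simp add: norm_mult mult_ac)
      qed
    qed
    then show ?thesis
      using int unfolding K_def by (subst (asm) set_integral_diff) auto
  qed
  have "\<exists>k. \<forall>w\<in>{w. 0 < Re w}. w powr of_real s * K (s - 1) w = k"
  proof (rule has_field_derivative_zero_constant)
    show "convex {w. 0 < Re w}"
      using convex_halfspace_Re_gt[of 0] by simp
    fix w :: complex assume "w \<in> {w. 0 < Re w}"
    then have w: "0 < Re w" "w \<noteq> 0" "w \<notin> \<real>\<^sub>\<le>\<^sub>0"
      by (auto simp: complex_nonpos_Reals_iff)
    have "((\<lambda>w. w powr of_real s * K (s - 1) w) has_field_derivative
        of_real s * w powr (of_real s - 1) * K (s - 1) w + w powr of_real s * (- K s w)) (at w)"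
      using w by (auto intro!: derivative_eq_intros K' has_field_derivative_powr)
    also have "of_real s * w powr (of_real s - 1) * K (s - 1) w = w powr (of_real s - 1) * (w * K s w)"
      using rec[OF w(1)] by (simp add: mult_ac)
    also have "\<dots> = w powr of_real s * K s w"
      using w by (simp add: powr_diff)
    finally show "((\<lambda>w. w powr of_real s * K (s - 1) w) has_field_derivative 0) (at w within {w. 0 < Re w})"
      by (simp add: has_field_derivative_at_within)
  qed
  then obtain k where k: "\<And>w. 0 < Re w \<Longrightarrow> w powr of_real s * K (s - 1) w = k" by auto
  have "k = K (s - 1) 1"
    using k[of 1] by simp
  also have "\<dots> = (LBINT x:{0<..}. complex_of_real (x powr (s - 1) * exp (- x)))"
    unfolding K_def by (simp add: exp_of_real [symmetric] mult_ac flip: exp_of_real)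
  also have "\<dots> = of_real (Gamma s)"
    by (simp only: Gamma_conv_set_integral[OF s] set_integral_complex_of_real)
  finally have "k = of_real (Gamma s)" .
  moreover have "w powr of_real s \<noteq> 0" using w by auto
  ultimately have "K (s - 1) w = of_real (Gamma s) / w powr of_real s"
    using k[OF w] by (simp add: eq_divide_eq mult.commute)
  then show ?thesis
    by (simp add: K_def powr_minus divide_inverse)
qed

lemma Gamma_one_minus:
  fixes c :: real
  assumes c: "0 < c" "c < 1"
  shows "Gamma (1 - c) = - c * Gamma (- c)"
proof -
  have "- c \<notin> \<int>\<^sub>\<le>\<^sub>0"
  proof
    assume "- c \<in> \<int>\<^sub>\<le>\<^sub>0"
    then obtain n :: int where "- c = of_int n" by (auto elim!: nonpos_Ints_cases)
    then have "of_int (- 1) < real_of_int n" "real_of_int n < of_int 0" using c by auto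
    then show False unfolding of_int_less_iff by simp
  qed
  from Gamma_plus1[OF this] show ?thesis by simp
qed

section \<open>The exponent of the averaged density\<close>

text \<open>The majorant used up to the boundary line Re u = -b, where no exponential decay is left.
  It is integrable at 0 by \<open>c < 1\<close> and at infinity by \<open>0 < c\<close>.\<close>

lemma set_integrable_min_powr:
  fixes c :: real
  assumes "0 < c" "c < 1"
  shows "set_integrable lborel {0<..} (\<lambda>x. min 1 x * x powr (- c - 1))"
proof -
  have "((\<lambda>x. x powr (- c - 1)) has_integral - (1 powr (- c - 1 + 1)) / (- c - 1 + 1)) {1..}"
    by (rule has_integral_powr_to_inf) (use assms in auto)
  then have "(\<lambda>x. x powr (- c - 1)) absolutely_integrable_on {1..}"
    by (intro nonnegative_absolutely_integrable_1) auto
  then have a: "set_integrable lborel {1..} (\<lambda>x. x powr (- c - 1))"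
    unfolding set_integrable_def by (subst (asm) integrable_completion) auto
  have "set_integrable lborel {0<..} (\<lambda>x. x powr (- c) * exp (- 1 * x))"
    using assms by (intro set_integrable_powr_exp) auto
  then have "set_integrable lborel {0<..<1} (\<lambda>x. x powr (- c) * exp (- 1 * x))"
    by (rule set_integrable_subset) auto
  \<comment> \<open>On (0,1) the factor exp (-x) is at least exp (-1), so after multiplication by
    \<open>exp 1\<close> the Gamma integrand dominates the bare power.\<close>
  then have "set_integrable lborel {0<..<1} (\<lambda>x. exp 1 * (x powr (- c) * exp (- 1 * x)))"
    by simp
  then have b: "set_integrable lborel {0<..<1} (\<lambda>x. x powr (- c))"
  proof (rule set_integrable_bound)
    show "set_borel_measurable lborel {0<..<1} (\<lambda>x. x powr (- c))"
      unfolding set_borel_measurable_def by measurable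
    show "AE x in lborel. x \<in> {0<..<1} \<longrightarrow> norm (x powr - c) \<le> norm (exp 1 * (x powr - c * exp (- 1 * x)))"
    proof (intro AE_I2 impI)
      fix x :: real assume "x \<in> {0<..<1}"
      then have "x powr - c * 1 \<le> x powr - c * exp (1 - x)"
        by (intro mult_left_mono) auto
      also have "\<dots> = exp 1 * (x powr - c * exp (- 1 * x))"
        by (simp add: exp_diff exp_minus field_simps)
      finally show "norm (x powr - c) \<le> norm (exp 1 * (x powr - c * exp (- 1 * x)))"
        by simp
    qed
  qed
  have "set_integrable lborel {1..} (\<lambda>x. min 1 x * x powr (- c - 1))"
    using a by (rule set_integrable_cong[THEN iffD1, rotated -1]) auto
  moreover have "set_integrable lborel {0<..<1} (\<lambda>x. min 1 x * x powr (- c - 1))"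
    using b by (rule set_integrable_cong[THEN iffD1, rotated -1]) (auto simp: powr_diff powr_minus field_simps)
  ultimately have "set_integrable lborel ({0<..<1} \<union> {1..}) (\<lambda>x. min 1 x * x powr (- c - 1))"
    by (intro set_integrable_Un) auto
  also have "{0<..<1} \<union> {1..} = {0::real<..}" by auto
  finally show ?thesis .
qed

text \<open>Origin: weighting the jumps by a uniform y in (0,1) turns the density z powr (-c-1) exp
  (-b z) into the integral over y of its value at z = x/y, divided by y. Substituting b x / y gives
  b powr (c+1) \<Gamma>(-c-1, b x), and the recurrence for incomplete Gamma functions rewrites c+1
  times this as the body.\<close>

definition avg_density :: "real \<Rightarrow> real \<Rightarrow> real \<Rightarrow> real" where
  "avg_density b c x = exp (- b * x) / x powr (c + 1) - b powr (c + 1) * upper_Gamma (- c) (b * x)"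

text \<open>The integrand carries no truncation term: \<open>min 1 x\<close> integrates against the
  density, so the small jumps are summable, as for any subordinator.\<close>

definition avg_exponent :: "real \<Rightarrow> real \<Rightarrow> complex \<Rightarrow> complex" where
  "avg_exponent b c u = (LBINT x:{0<..}. (exp (- u * of_real x) - 1) * of_real (avg_density b c x))"

context
  fixes b c :: real
  assumes b: "0 < b" and c: "0 < c" "c < 1"
begin

lemma avg_density_le:
  assumes "0 < x"
  shows "avg_density b c x \<le> x powr (- c - 1) * exp (- b * x)"
proof -
  have "avg_density b c x \<le> exp (- b * x) / x powr (c + 1)"
    unfolding avg_density_def by (simp add: upper_Gamma_nonneg)
  also have "\<dots> = x powr (- c - 1) * exp (- b * x)"
    by (simp add: powr_minus_divide powr_diff powr_add)
  finally show ?thesis .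
qed

lemma avg_density_nonneg:
  assumes "0 < x"
  shows "0 \<le> avg_density b c x"
proof -
  have "b powr (c + 1) * upper_Gamma (- c) (b * x) \<le> b powr (c + 1) * ((b * x) powr (- c - 1) * exp (- (b * x)))"
    using upper_Gamma_le[of "b * x" "- c"] b c assms by (intro mult_left_mono) auto
  also have "\<dots> = exp (- b * x) / x powr (c + 1)"
    using b assms by (simp add: powr_mult powr_minus_divide powr_diff powr_add field_simps)
  finally show ?thesis by (simp add: avg_density_def)
qed

text \<open>The derivative of the exponential factor contributes -b x powr (-c-1) exp (-b x), which
  the incomplete Gamma term cancels. The rest is -(c+1)/x times the tempered stable density.\<close>

lemma has_real_derivative_avg_density:
  assumes "0 < x"
  shows "(avg_density b c has_real_derivative - (c + 1) * x powr (- c - 2) * exp (- b * x)) (at x)"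
proof -
  have x: "0 < b * x" using b assms by simp
  have "((\<lambda>x. upper_Gamma (- c) (b * x)) has_real_derivative - ((b * x) powr (- c - 1) * exp (- (b * x))) * b) (at x)"
    by (rule DERIV_chain2[where f = "upper_Gamma (- c)" and g = "\<lambda>x. b * x", OF has_real_derivative_upper_Gamma[OF x, of "- c"]])
       (auto intro!: derivative_eq_intros)
  then have "((\<lambda>x. x powr (- c - 1) * exp (- b * x) - b powr (c + 1) * upper_Gamma (- c) (b * x)) has_real_derivative
      ((- c - 1) * x powr (- c - 1 - 1) * exp (- b * x) + (exp (- b * x) * - b) * x powr (- c - 1)) -
      b powr (c + 1) * (- ((b * x) powr (- c - 1) * exp (- (b * x))) * b)) (at x)"
    using assms by (auto intro!: derivative_eq_intros)
  also have "b powr (c + 1) * (- ((b * x) powr (- c - 1) * exp (- (b * x))) * b) = 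
      - (b powr (c + 1) * b powr (- c - 1)) * x powr (- c - 1) * exp (- b * x) * b"
    using b assms by (simp add: powr_mult)
  also have "b powr (c + 1) * b powr (- c - 1) = 1"
    using b by (simp flip: powr_add)
  finally have "((\<lambda>x. x powr (- c - 1) * exp (- b * x) - b powr (c + 1) * upper_Gamma (- c) (b * x)) has_real_derivative
      - (c + 1) * x powr (- c - 2) * exp (- b * x)) (at x)"
    by (simp add: algebra_simps)
  moreover have "avg_density b c = (\<lambda>x. x powr (- c - 1) * exp (- b * x) - b powr (c + 1) * upper_Gamma (- c) (b * x))"
    by (auto simp: avg_density_def fun_eq_iff powr_minus_divide powr_diff powr_add)
  ultimately show ?thesis by simp
qed

lemma continuous_avg_density: "continuous_on {0<..} (avg_density b c)"
  by (auto intro!: continuous_at_imp_continuous_on DERIV_isCont[OF has_real_derivative_avg_density])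

lemma borel_measurable_avg_density [measurable]:
  "(\<lambda>x. indicator {0<..} x * avg_density b c x) \<in> borel_measurable borel"
  using borel_measurable_continuous_on_indicator[OF _ continuous_avg_density] by simp

text \<open>The growth of exp (-u x) is absorbed by the factor exp (-b x) in the bound on the
  density, which works up to and including Re u = -b. The two estimates
  \<open>norm u * x * m\<close> and \<open>2 * m\<close> combine into
  \<open>min 1 x\<close>.\<close>

lemma avg_integrand_bound:
  assumes "0 < x" "- b \<le> Re u"
  shows "norm ((exp (- u * of_real x) - 1) * of_real (avg_density b c x)) \<le> (2 + norm u) * (min 1 x * x powr (- c - 1))"
proof -
  define m where "m = max 1 (exp (- Re u * x))"
  have "0 \<le> (b + Re u) * x" "0 \<le> b * x" using assms b by auto
  then have m: "exp (- b * x) * m \<le> 1" "1 \<le> m"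
    by (auto simp: m_def max_def algebra_simps simp flip: exp_add)
  have "norm (exp (- u * of_real x) - 1) \<le> norm u * x * m"
    using norm_exp_minus_1_le[of "- u * of_real x"] assms by (simp add: m_def norm_mult)
  moreover have "norm (exp (- u * of_real x) - 1) \<le> 2 * m"
    using norm_triangle_ineq4[of "exp (- u * of_real x)" 1] by (simp add: m_def)
  ultimately have "norm (exp (- u * of_real x) - 1) \<le> (2 + norm u) * min 1 x * m"
  proof -
    assume a: "norm (exp (- u * of_real x) - 1) \<le> norm u * x * m" "norm (exp (- u * of_real x) - 1) \<le> 2 * m"
    have "norm u * x * m \<le> (2 + norm u) * x * m" "2 * m \<le> (2 + norm u) * 1 * m"
      using assms m by (auto intro!: mult_right_mono)
    with a show ?thesis by (simp only: min_def) (auto split: if_splits)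
  qed
  moreover have "\<bar>avg_density b c x\<bar> \<le> x powr (- c - 1) * exp (- b * x)"
    using avg_density_le avg_density_nonneg assms by simp
  ultimately have "norm ((exp (- u * of_real x) - 1) * of_real (avg_density b c x))
      \<le> ((2 + norm u) * min 1 x * m) * (x powr (- c - 1) * exp (- b * x))"
    using assms m unfolding norm_mult norm_of_real by (intro mult_mono) auto
  also have "\<dots> = ((2 + norm u) * (min 1 x * x powr (- c - 1))) * (exp (- b * x) * m)"
    by (simp add: mult_ac)
  also have "\<dots> \<le> ((2 + norm u) * (min 1 x * x powr (- c - 1))) * 1"
    using m assms by (intro mult_left_mono) auto
  finally show ?thesis by simp
qed

lemma avg_integrand_measurable [measurable]:
  "(\<lambda>x. indicator {0<..} x *\<^sub>R (f x * complex_of_real (avg_density b c x))) \<in> borel_measurable borel"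
  if [measurable]: "f \<in> borel_measurable borel" for f
proof -
  have "(\<lambda>x. f x * complex_of_real (indicator {0<..} x * avg_density b c x)) \<in> borel_measurable borel"
    by measurable
  also have "(\<lambda>x. f x * complex_of_real (indicator {0<..} x * avg_density b c x)) =
    (\<lambda>x. indicator {0<..} x *\<^sub>R (f x * complex_of_real (avg_density b c x)))"
    by (auto simp: indicator_def fun_eq_iff)
  finally show ?thesis .
qed

lemma avg_integrand_integrable:
  assumes "- b \<le> Re u"
  shows "set_integrable lborel {0<..} (\<lambda>x. (exp (- u * of_real x) - 1) * of_real (avg_density b c x))"
proof (rule set_integrable_bound)
  show "set_integrable lborel {0<..} (\<lambda>x. (2 + norm u) * (min 1 x * x powr (- c - 1)))"
    using set_integrable_min_powr[OF c] by simp
  show "set_borel_measurable lborel {0<..} (\<lambda>x. (exp (- u * of_real x) - 1) * complex_of_real (avg_density b c x))"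
    unfolding set_borel_measurable_def by simp
  show "AE x in lborel. x \<in> {0<..} \<longrightarrow>
      norm ((exp (- u * of_real x) - 1) * complex_of_real (avg_density b c x)) \<le>
      norm ((2 + norm u) * (min 1 x * x powr (- c - 1)))"
    using avg_integrand_bound[OF _ assms] by (intro AE_I2 impI) (auto simp: abs_mult)
qed

lemma continuous_on_avg_exponent: "continuous_on {u. - b \<le> Re u} (avg_exponent b c)"
  unfolding continuous_on_sequentially
proof (intro allI ballI impI)
  fix Y u assume "u \<in> {u. - b \<le> Re u}" and Y: "(\<forall>n. Y n \<in> {u. - b \<le> Re u}) \<and> Y \<longlonglongrightarrow> u"
  \<comment> \<open>A convergent sequence is bounded, so 2 + B serves as one constant in
    \<open>avg_integrand_bound\<close> along the whole sequence.\<close>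
  then obtain B where B: "\<And>n. norm (Y n) \<le> B"
    using convergent_imp_Bseq[of Y] by (auto simp: convergent_def Bseq_def)
  have "(\<lambda>n. LBINT x. indicator {0<..} x *\<^sub>R ((exp (- Y n * of_real x) - 1) * complex_of_real (avg_density b c x))) \<longlonglongrightarrow>
    (LBINT x. indicator {0<..} x *\<^sub>R ((exp (- u * of_real x) - 1) * complex_of_real (avg_density b c x)))"
  proof (rule integral_dominated_convergence)
    show "integrable lborel (\<lambda>x. indicator {0<..} x *\<^sub>R ((2 + B) * (min 1 x * x powr (- c - 1))))"
      using set_integrable_mult_right[OF set_integrable_min_powr[OF c], of "2 + B"] 
      by (simp add: set_integrable_def)
    show "AE x in lborel. norm (indicator {0<..} x *\<^sub>R ((exp (- Y n * of_real x) - 1) * complex_of_real (avg_density b c x)))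
       \<le> indicator {0<..} x *\<^sub>R ((2 + B) * (min 1 x * x powr (- c - 1)))" for n
    proof (rule AE_I2)
      fix x :: real
      show "norm (indicator {0<..} x *\<^sub>R ((exp (- Y n * of_real x) - 1) * complex_of_real (avg_density b c x)))
       \<le> indicator {0<..} x *\<^sub>R ((2 + B) * (min 1 x * x powr (- c - 1)))"
      proof (cases "0 < x")
        case True
        have "norm ((exp (- Y n * of_real x) - 1) * complex_of_real (avg_density b c x))
          \<le> (2 + norm (Y n)) * (min 1 x * x powr (- c - 1))"
          using avg_integrand_bound[OF True, of "Y n"] Y by auto
        also have "\<dots> \<le> (2 + B) * (min 1 x * x powr (- c - 1))"
          using B[of n] True by (intro mult_right_mono) auto
        finally show ?thesis using True by simp
      qed auto
    qed
    show "AE x in lborel. (\<lambda>n. indicator {0<..} x *\<^sub>R ((exp (- Y n * of_real x) - 1) * complex_of_real (avg_density b c x)))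
      \<longlonglongrightarrow> indicator {0<..} x *\<^sub>R ((exp (- u * of_real x) - 1) * complex_of_real (avg_density b c x))"
      using Y by (intro AE_I2 tendsto_intros) auto
  qed auto
  then show "(avg_exponent b c \<circ> Y) \<longlonglongrightarrow> avg_exponent b c u"
    by (simp add: comp_def avg_exponent_def set_lebesgue_integral_def)
qed

lemma avg_exponent_0 [simp]: "avg_exponent b c 0 = 0"
  by (simp add: avg_exponent_def)

lemma tempered_stable_integrable:
  assumes u: "- b < Re u"
  shows "set_integrable lborel {0<..} (\<lambda>x. (exp (- u * of_real x) - 1) * complex_of_real (x powr (- c - 1) * exp (- b * x)))"
proof (rule set_integrable_bound)
  \<comment> \<open>Bounding the maximum in \<open>norm_exp_minus_1_le\<close> by a sum splits the
    majorant into two Gamma integrands; the second is integrable because b + Re u is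
    positive.\<close>
  show "set_integrable lborel {0<..} (\<lambda>x. norm u * (x powr (- c) * exp (- b * x) + x powr (- c) * exp (- (b + Re u) * x)))"
    using u b c by (intro set_integrable_mult_right set_integral_add set_integrable_powr_exp) auto
  show "set_borel_measurable lborel {0<..} (\<lambda>x. (exp (- u * of_real x) - 1) * complex_of_real (x powr (- c - 1) * exp (- b * x)))"
    unfolding set_borel_measurable_def by measurable
  show "AE x in lborel. x \<in> {0<..} \<longrightarrow> norm (((exp (- u * of_real x) - 1) * complex_of_real (x powr (- c - 1) * exp (- b * x)))) \<le>
     norm (norm u * (x powr (- c) * exp (- b * x) + x powr (- c) * exp (- (b + Re u) * x)))"
  proof (intro AE_I2 impI)
    fix x :: real assume x: "x \<in> {0<..}"
    have "norm (((exp (- u * of_real x) - 1) * complex_of_real (x powr (- c - 1) * exp (- b * x)))) \<le> (norm u * x * max 1 (exp (- Re u * x))) * (x powr (- c - 1) * exp (- b * x))"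
      using norm_exp_minus_1_le[of "- u * of_real x"] x
      unfolding norm_mult norm_of_real by (intro mult_mono) (auto simp: norm_mult)
    also have "\<dots> \<le> (norm u * x * (1 + exp (- Re u * x))) * (x powr (- c - 1) * exp (- b * x))"
      using x by (intro mult_right_mono mult_left_mono) auto
    also have "\<dots> = norm u * (x powr (- c) * exp (- b * x) + x powr (- c) * (exp (- b * x) * exp (- Re u * x)))"
      using x by (simp add: powr_diff algebra_simps)
    also have "exp (- b * x) * exp (- Re u * x) = exp (- (b + Re u) * x)"
      by (simp add: algebra_simps flip: exp_add)
    finally show "norm (((exp (- u * of_real x) - 1) * complex_of_real (x powr (- c - 1) * exp (- b * x)))) \<le> norm (norm u * (x powr (- c) * exp (- b * x) + x powr (- c) * exp (- (b + Re u) * x)))"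
      by simp
  qed
qed

lemma has_field_derivative_times_avg_exponent:
  assumes u: "- b < Re u"
  shows "((\<lambda>u. u * avg_exponent b c u) has_field_derivative of_real (c + 1) * 
    (LBINT x:{0<..}. (exp (- u * of_real x) - 1) * of_real (x powr (- c - 1) * exp (- b * x)))) (at u)"
proof -
  have int1: "set_integrable lborel {0<..} (\<lambda>x. (exp (- u * of_real x) - 1) * of_real (avg_density b c x))"
    using u by (intro avg_integrand_integrable) auto
  have int2r: "set_integrable lborel {0<..} (\<lambda>x. x * avg_density b c x * exp (- r * x))" if "- b < r" for r
  proof (rule set_integrable_bound)
    show "set_integrable lborel {0<..} (\<lambda>x. x powr (- c) * exp (- (b + r) * x))"
      using that c by (intro set_integrable_powr_exp) auto
    have "(\<lambda>x. x * (indicator {0<..} x * avg_density b c x) * exp (- r * x)) \<in> borel_measurable borel"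
      by measurable
    then show "set_borel_measurable lborel {0<..} (\<lambda>x. x * avg_density b c x * exp (- r * x))"
      by (simp add: set_borel_measurable_def mult_ac)
    show "AE x in lborel. x \<in> {0<..} \<longrightarrow> norm (x * avg_density b c x * exp (- r * x)) \<le>
        norm (x powr (- c) * exp (- (b + r) * x))"
    proof (intro AE_I2 impI)
      fix x :: real assume x: "x \<in> {0<..}"
      have "norm (x * avg_density b c x * exp (- r * x)) = x * avg_density b c x * exp (- r * x)"
        using x avg_density_nonneg[of x] by (simp add: abs_mult)
      also have "\<dots> \<le> x * (x powr (- c - 1) * exp (- b * x)) * exp (- r * x)"
        using x avg_density_le[of x] by (intro mult_left_mono mult_right_mono) auto
      also have "\<dots> = x powr (- c) * (exp (- b * x) * exp (- r * x))"
        using x by (simp add: powr_diff)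
      also have "\<dots> = x powr (- c) * exp (- (b + r) * x)"
        by (simp add: algebra_simps flip: exp_add)
      finally show "norm (x * avg_density b c x * exp (- r * x)) \<le> norm (x powr (- c) * exp (- (b + r) * x))"
        by simp
    qed
  qed
  have int2: "set_integrable lborel {0<..} (\<lambda>x. exp (- u * of_real x) * of_real (x * avg_density b c x))"
  proof (rule set_integrable_bound[OF int2r[OF u]])
    have "(\<lambda>x. indicator {0<..} x *\<^sub>R ((exp (- u * of_real x) * of_real x) * complex_of_real (avg_density b c x)))
      \<in> borel_measurable borel"
      by (intro avg_integrand_measurable) measurable
    then show "set_borel_measurable lborel {0<..} (\<lambda>x. exp (- u * of_real x) * complex_of_real (x * avg_density b c x))"
      by (simp add: set_borel_measurable_def mult_ac)
  qed (auto simp: norm_mult abs_mult)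
  note int3 = tempered_stable_integrable[OF u]
  have deriv: "(avg_exponent b c has_field_derivative
      - (LBINT x:{0<..}. exp (- u * of_real x) * of_real (x * avg_density b c x))) (at u)"
    unfolding avg_exponent_def
    by (rule has_field_derivative_Laplace_integral[where \<sigma> = "- b"])
       (use u int2r avg_integrand_integrable in auto)
  \<comment> \<open>The product rule yields three terms. The first two integrate to the derivative
    of \<open>u * avg_exponent b c u\<close>; in the third, the factor \<open>x\<close> lifts the x
    powr (-c-2) from the derivative of the density to the tempered stable x powr (-c-1).\<close>
  define H where "H = (\<lambda>x. (of_real x * (exp (- u * of_real x) - 1)) * complex_of_real (avg_density b c x))"
  have H_bound: "norm (H x) \<le> (2 + norm u) * (x * (min 1 x * x powr (- c - 1)))" if "0 < x" for x
  proof -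
    have "norm (H x) = x * norm ((exp (- u * of_real x) - 1) * complex_of_real (avg_density b c x))"
      using that by (simp add: H_def norm_mult)
    also have "\<dots> \<le> x * ((2 + norm u) * (min 1 x * x powr (- c - 1)))"
      using that u by (intro mult_left_mono avg_integrand_bound) auto
    finally show ?thesis by (simp add: mult_ac)
  qed
  have "(LBINT x:{0<..}. (exp (- u * of_real x) - 1) * of_real (avg_density b c x)
      - u * (exp (- u * of_real x) * of_real (x * avg_density b c x)) - of_real (c + 1) * ((exp (- u * of_real x) - 1) * of_real (x powr (- c - 1) * exp (- b * x)))) = 0 - 0"
  proof (rule set_integral_FTC_greaterThan[where F = H])
    fix x :: real assume x: "0 < x"
    have "((\<lambda>x. of_real x * (exp (- u * of_real x) - 1)) has_vector_derivative
        (exp (- u * of_real x) - 1) - u * of_real x * exp (- u * of_real x)) (at x)"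
      by (rule has_vector_derivative_real_field) (auto intro!: derivative_eq_intros simp: algebra_simps)
    moreover have "((\<lambda>x. complex_of_real (avg_density b c x)) has_vector_derivative
        of_real (- (c + 1) * x powr (- c - 2) * exp (- b * x))) (at x)"
      using has_real_derivative_avg_density[OF x]
      by (intro has_vector_derivative_of_real) (simp add: has_real_derivative_iff_has_vector_derivative)
    ultimately have "(H has_vector_derivative 
        (of_real x * (exp (- u * of_real x) - 1)) * of_real (- (c + 1) * x powr (- c - 2) * exp (- b * x)) +
        ((exp (- u * of_real x) - 1) - u * of_real x * exp (- u * of_real x)) * of_real (avg_density b c x)) (at x)"
      unfolding H_def by (rule has_vector_derivative_mult)
    moreover have "x powr (- c - 1) = x * x powr (- c - 2)"
      using x by (simp add: powr_diff power2_eq_square)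
    ultimately show "(H has_vector_derivative (exp (- u * of_real x) - 1) * of_real (avg_density b c x)
      - u * (exp (- u * of_real x) * of_real (x * avg_density b c x)) - of_real (c + 1) * ((exp (- u * of_real x) - 1) * of_real (x powr (- c - 1) * exp (- b * x)))) (at x)"
      using x by (simp add: algebra_simps)
    have "isCont (avg_density b c) x"
      using has_real_derivative_avg_density[OF x] by (rule DERIV_isCont)
    then show "isCont (\<lambda>x. (exp (- u * of_real x) - 1) * of_real (avg_density b c x)
      - u * (exp (- u * of_real x) * of_real (x * avg_density b c x)) - of_real (c + 1) * ((exp (- u * of_real x) - 1) * of_real (x powr (- c - 1) * exp (- b * x)))) x"
      using x by (intro continuous_intros) auto
  next
    show "set_integrable lborel {0<..} (\<lambda>x. (exp (- u * of_real x) - 1) * of_real (avg_density b c x)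
      - u * (exp (- u * of_real x) * of_real (x * avg_density b c x)) - of_real (c + 1) * ((exp (- u * of_real x) - 1) * of_real (x powr (- c - 1) * exp (- b * x))))"
      by (intro set_integral_diff set_integrable_mult_right int1 int2 int3)
    \<comment> \<open>Both boundary terms vanish because 0 < c < 1: \<open>H\<close> is bounded by a
      multiple of x powr (1-c) near 0 and of x powr (-c) near infinity.\<close>
    show "(H \<longlongrightarrow> 0) (at_right 0)"
    proof (rule Lim_null_comparison)
      have "\<forall>\<^sub>F x in at_right (0::real). x < 1"
        by (rule eventually_at_rightI[of 0 1]) auto
      then show "\<forall>\<^sub>F x in at_right 0. norm (H x) \<le> (2 + norm u) * x powr (1 - c)"
        using eventually_at_right_less[of 0]
      proof eventually_elim
        case (elim x)
        then have "x * (min 1 x * x powr (- c - 1)) = x powr (1 - c)"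
          by (simp add: powr_diff powr_minus divide_inverse)
        with H_bound[of x] elim show ?case by simp
      qed
      have "((\<lambda>x. x powr (1 - c)) \<longlongrightarrow> 0) (at_right 0)"
        using c by real_asymp
      then show "((\<lambda>x. (2 + norm u) * x powr (1 - c)) \<longlongrightarrow> 0) (at_right 0)"
        by (rule tendsto_mult_right_zero)
    qed
    show "(H \<longlongrightarrow> 0) at_top"
    proof (rule Lim_null_comparison)
      show "\<forall>\<^sub>F x in at_top. norm (H x) \<le> (2 + norm u) * x powr (- c)"
        using eventually_gt_at_top[of 1]
      proof eventually_elim
        case (elim x)
        then have "x * (min 1 x * x powr (- c - 1)) = x powr (- c)"
          by (simp add: powr_diff)
        with H_bound[of x] elim show ?case by simp
      qed
      have "((\<lambda>x. x powr (- c)) \<longlongrightarrow> 0) at_top"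
        using c by real_asymp
      then show "((\<lambda>x. (2 + norm u) * x powr (- c)) \<longlongrightarrow> 0) at_top"
        by (rule tendsto_mult_right_zero)
    qed
  qed
  moreover have i2: "set_integrable lborel {0<..} (\<lambda>x. u * (exp (- u * of_real x) * of_real (x * avg_density b c x)))"
    by (intro set_integrable_mult_right int2)
  moreover have i3: "set_integrable lborel {0<..} (\<lambda>x. of_real (c + 1) *
      ((exp (- u * of_real x) - 1) * of_real (x powr (- c - 1) * exp (- b * x))))"
    by (intro set_integrable_mult_right int3)
  ultimately have eq: "avg_exponent b c u - u * (LBINT x:{0<..}. exp (- u * of_real x) * of_real (x * avg_density b c x)) =
      of_real (c + 1) * (LBINT x:{0<..}. (exp (- u * of_real x) - 1) * of_real (x powr (- c - 1) * exp (- b * x)))"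
    unfolding set_integral_diff(2)[OF set_integral_diff(1)[OF int1 i2] i3] set_integral_diff(2)[OF int1 i2]
      set_integral_mult_right avg_exponent_def by simp
  define J where "J = (LBINT x:{0<..}. exp (- u * of_real x) * complex_of_real (x * avg_density b c x))"
  have "((\<lambda>u. u * avg_exponent b c u) has_field_derivative 1 * avg_exponent b c u + - J * u) (at u)"
    using DERIV_mult[OF DERIV_ident deriv] unfolding J_def .
  also have "1 * avg_exponent b c u + - J * u = avg_exponent b c u - u * J"
    by simp
  also note eq [folded J_def]
  finally show ?thesis .
qed

text \<open>Identifies the Laplace exponent given for X as that of the jump density a x powr (-c-1)
  exp (-b x). Differentiation in \<open>u\<close> removes the -1 and softens the singularity to x
  powr (-c), where the Gamma integral with parameter 1-c applies; \<open>u = 0\<close> fixes the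
  constant.\<close>

lemma tempered_stable_exponent:
  assumes u: "- b < Re u"
  shows "(LBINT x:{0<..}. (exp (- u * of_real x) - 1) * of_real (x powr (- c - 1) * exp (- b * x))) =
    of_real (Gamma (- c)) * ((of_real b + u) powr of_real c - of_real (b powr c))"
proof -
  define P where "P = (\<lambda>u. LBINT x:{0<..}. (exp (- u * of_real x) - 1) * complex_of_real (x powr (- c - 1) * exp (- b * x)))"
  have P': "(P has_field_derivative - (of_real (Gamma (1 - c)) * (of_real b + u) powr (of_real c - 1))) (at u)"
    if u: "- b < Re u" for u
  proof -
    have "(P has_field_derivative
        - (LBINT x:{0<..}. exp (- u * of_real x) * of_real (x * (x powr (- c - 1) * exp (- b * x))))) (at u)"
      unfolding P_def
    proof (rule has_field_derivative_Laplace_integral[where \<sigma> = "- b"])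
      show "set_integrable lborel {0<..} (\<lambda>x. x * (x powr (- c - 1) * exp (- b * x)) * exp (- r * x))"
        if "- b < r" for r
      proof -
        have "set_integrable lborel {0<..} (\<lambda>x. x powr (- c) * exp (- (b + r) * x))"
          using that c by (intro set_integrable_powr_exp) auto
        also have "?this \<longleftrightarrow> ?thesis"
          by (intro set_integrable_cong) (auto simp: powr_diff algebra_simps exp_add [symmetric])
        finally show ?thesis .
      qed
    qed (use u tempered_stable_integrable in auto)
    also have "(LBINT x:{0<..}. exp (- u * of_real x) * of_real (x * (x powr (- c - 1) * exp (- b * x)))) =
        (LBINT x:{0<..}. exp (- (of_real b + u) * of_real x) * of_real (x powr (1 - c - 1)))"
      by (intro set_lebesgue_integral_cong)
         (auto simp: powr_diff algebra_simps exp_diff exp_minus exp_add exp_of_real [symmetric] divide_inverse)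
    also have "\<dots> = of_real (Gamma (1 - c)) * (of_real b + u) powr (- of_real (1 - c))"
      using u c by (intro Gamma_integral_scaled_complex) auto
    finally show ?thesis by simp
  qed
  have "\<exists>k. \<forall>u\<in>{u. - b < Re u}. P u - of_real (Gamma (- c)) * (of_real b + u) powr of_real c = k"
  proof (rule has_field_derivative_zero_constant)
    show "convex {u. - b < Re u}"
      using convex_halfspace_Re_gt[of "- b"] by simp
    fix u :: complex assume "u \<in> {u. - b < Re u}"
    then have u: "- b < Re u" "of_real b + u \<notin> \<real>\<^sub>\<le>\<^sub>0"
      by (auto simp: complex_nonpos_Reals_iff)
    have "((\<lambda>u. (of_real b + u) powr of_real c) has_field_derivative
        of_real c * (of_real b + u) powr (of_real c - 1) * 1) (at u)"
      by (rule DERIV_chain2[where f = "\<lambda>z. z powr of_real c" and g = "\<lambda>u. of_real b + u",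
            OF has_field_derivative_powr[OF u(2), of "of_real c"]])
         (auto intro!: derivative_eq_intros)
    then have "((\<lambda>u. P u - of_real (Gamma (- c)) * (of_real b + u) powr of_real c) has_field_derivative 0) (at u)"
      using DERIV_diff[OF P'[OF u(1)] DERIV_cmult[of _ _ _ _ "of_real (Gamma (- c))"]]
      by (fastforce simp: Gamma_one_minus[OF c])
    then show "((\<lambda>u. P u - of_real (Gamma (- c)) * (of_real b + u) powr of_real c) has_field_derivative 0)
        (at u within {u. - b < Re u})"
      by (rule has_field_derivative_at_within)
  qed
  then obtain k where k: "\<And>u. - b < Re u \<Longrightarrow> P u - of_real (Gamma (- c)) * (of_real b + u) powr of_real c = k"
    by auto
  have "k = - of_real (Gamma (- c)) * of_real (b powr c)"
    using k[of 0] b by (simp add: P_def powr_of_real)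
  with k[OF u] show ?thesis
    by (simp add: P_def algebra_simps)
qed

text \<open>Both sides have the same derivative on a convex set and agree at 0. The right-hand side
  is the form in which the limit of the Riemann sums arrives.\<close>

lemma times_avg_exponent:
  assumes u: "- b < Re u"
  shows "u * avg_exponent b c u = of_real (Gamma (- c)) *
    ((of_real b + u) powr of_real (c + 1) - of_real (b powr (c + 1)) - of_real (c + 1) * u * of_real (b powr c))"
proof -
  define G where "G = (\<lambda>u. of_real (Gamma (- c)) *
      ((of_real b + u) powr of_real (c + 1) - of_real (c + 1) * u * complex_of_real (b powr c)))"
  have "\<exists>k. \<forall>u\<in>{u. - b < Re u}. u * avg_exponent b c u - G u = k"
  proof (rule has_field_derivative_zero_constant)
    show "convex {u. - b < Re u}"
      using convex_halfspace_Re_gt[of "- b"] by simp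
    fix u :: complex assume "u \<in> {u. - b < Re u}"
    then have u: "- b < Re u" "of_real b + u \<notin> \<real>\<^sub>\<le>\<^sub>0"
      by (auto simp: complex_nonpos_Reals_iff)
    have "((\<lambda>u. (of_real b + u) powr of_real (c + 1)) has_field_derivative
        of_real (c + 1) * (of_real b + u) powr (of_real (c + 1) - 1) * 1) (at u)"
      by (rule DERIV_chain2[where f = "\<lambda>z. z powr of_real (c + 1)" and g = "\<lambda>u. of_real b + u",
            OF has_field_derivative_powr[OF u(2), of "of_real (c + 1)"]])
         (auto intro!: derivative_eq_intros)
    then have "((\<lambda>u. u * avg_exponent b c u - G u) has_field_derivative 0) (at u)"
      using has_field_derivative_times_avg_exponent[OF u(1)] unfolding G_def tempered_stable_exponent[OF u(1)]
      by - (rule DERIV_cong, (rule DERIV_diff DERIV_cmult DERIV_cmult_right DERIV_ident | assumption)+,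
            simp add: algebra_simps)
    then show "((\<lambda>u. u * avg_exponent b c u - G u) has_field_derivative 0) (at u within {u. - b < Re u})"
      by (rule has_field_derivative_at_within)
  qed
  then obtain k where k: "\<And>u. - b < Re u \<Longrightarrow> u * avg_exponent b c u - G u = k"
    by auto
  have "k = - of_real (Gamma (- c)) * of_real (b powr (c + 1))"
    using k[of 0] b powr_of_real[of b "c + 1"] by (simp add: G_def)
  with k[OF u] show ?thesis
    by (simp add: G_def algebra_simps)
qed

section \<open>The first moment on (0,1), source of the drift\<close>

lemma avg_density_first_moment_integrable:
  "set_integrable lborel {0<..<1} (\<lambda>x. x * avg_density b c x)"
proof -
  have "set_integrable lborel {0<..<1} (\<lambda>x. min 1 x * x powr (- c - 1))"
    by (rule set_integrable_subset[OF set_integrable_min_powr[OF c]]) auto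
  then show ?thesis
  proof (rule set_integrable_bound)
    have "(\<lambda>x. indicator {0<..<1} x * (x * (indicator {0<..} x * avg_density b c x))) \<in> borel_measurable borel"
      by measurable
    also have "(\<lambda>x. indicator {0<..<1} x * (x * (indicator {0<..} x * avg_density b c x))) =
        (\<lambda>x. indicator {0<..<1} x *\<^sub>R (x * avg_density b c x))"
      by (auto simp: indicator_def fun_eq_iff)
    finally show "set_borel_measurable lborel {0<..<1} (\<lambda>x. x * avg_density b c x)"
      by (simp add: set_borel_measurable_def)
    show "AE x in lborel. x \<in> {0<..<1} \<longrightarrow> norm (x * avg_density b c x) \<le> norm (min 1 x * x powr (- c - 1))"
    proof (intro AE_I2 impI)
      fix x :: real assume x: "x \<in> {0<..<1}"
      have "avg_density b c x \<le> x powr (- c - 1) * exp (- b * x)"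
        using x by (intro avg_density_le) auto
      also have "\<dots> \<le> x powr (- c - 1) * 1"
        using x b by (intro mult_left_mono) auto
      finally show "norm (x * avg_density b c x) \<le> norm (min 1 x * x powr (- c - 1))"
        using x avg_density_nonneg[of x] by (simp add: abs_mult)
    qed
  qed
qed

lemma avg_density_first_moment:
  "(LBINT x:{0<..<1}. x * avg_density b c x) = (c + 1) / (2 * b powr (1 - c)) *
    (Gamma (1 - c) +
      (upper_Gamma (2 - c) b - 2 * upper_Gamma (1 - c) b - b\<^sup>2 * upper_Gamma (- c) b) / (c + 1))"
proof -
  \<comment> \<open>Differentiating half of x squared times the density leaves the error -(c+1)/2 x
    powr (-c) exp (-b x). This is a multiple of the derivative of \<Gamma>(1-c, b x); the factor b
    powr (c-1) undoes the scaling by \<open>b\<close>.\<close>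
  define H where "H = (\<lambda>x. x\<^sup>2 * avg_density b c x / 2 - (c + 1) / 2 * b powr (c - 1) * upper_Gamma (1 - c) (b * x))"
  have H': "(H has_real_derivative x * avg_density b c x) (at x)" if x: "0 < x" for x
  proof -
    have bx: "0 < b * x" using b x by simp
    have "((\<lambda>x. upper_Gamma (1 - c) (b * x)) has_real_derivative - ((b * x) powr (1 - c - 1) * exp (- (b * x))) * b) (at x)"
      by (rule DERIV_chain2[where f = "upper_Gamma (1 - c)" and g = "\<lambda>x. b * x",
            OF has_real_derivative_upper_Gamma[OF bx, of "1 - c"]])
         (auto intro!: derivative_eq_intros)
    also have "- ((b * x) powr (1 - c - 1) * exp (- (b * x))) * b = - (b powr (1 - c) * x powr (- c) * exp (- b * x))"
      using b x by (simp add: powr_mult powr_diff powr_minus field_simps)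
    finally have g: "((\<lambda>x. upper_Gamma (1 - c) (b * x)) has_real_derivative
        - (b powr (1 - c) * x powr (- c) * exp (- b * x))) (at x)" .
    have x2: "((\<lambda>x. x\<^sup>2) has_real_derivative 2 * x) (at x)"
      by (auto intro!: derivative_eq_intros)
    have "(H has_real_derivative (2 * x * avg_density b c x + (- (c + 1) * x powr (- c - 2) * exp (- b * x)) * x\<^sup>2) / 2
       - (c + 1) / 2 * b powr (c - 1) * (- (b powr (1 - c) * x powr (- c) * exp (- b * x)))) (at x)"
      unfolding H_def
      by (intro DERIV_diff DERIV_cdivide DERIV_mult DERIV_cmult x2 g has_real_derivative_avg_density x)
    also have "(- (c + 1) * x powr (- c - 2) * exp (- b * x)) * x\<^sup>2 = - (c + 1) * x powr (- c) * exp (- b * x)"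
      using x by (simp add: powr_diff power2_eq_square)
    also have "(c + 1) / 2 * b powr (c - 1) * (- (b powr (1 - c) * x powr (- c) * exp (- b * x))) =
        - (c + 1) / 2 * (b powr (c - 1) * b powr (1 - c)) * x powr (- c) * exp (- b * x)"
      by (simp add: algebra_simps)
    also have "b powr (c - 1) * b powr (1 - c) = 1"
      using b by (simp flip: powr_add)
    finally show ?thesis by (simp add: field_simps)
  qed
  have "(LBINT x:{0<..<1}. x * avg_density b c x) = H 1 - (0 - (c + 1) / 2 * b powr (c - 1) * Gamma (1 - c))"
  proof (rule set_integral_FTC_greaterThanLessThan[where F = H])
    fix x :: real assume x: "0 < x" "x < 1"
    show "(H has_vector_derivative x * avg_density b c x) (at x)"
      using H'[OF x(1)] by (simp add: has_real_derivative_iff_has_vector_derivative)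
    show "isCont (\<lambda>x. x * avg_density b c x) x"
      by (intro continuous_intros DERIV_isCont[OF has_real_derivative_avg_density[OF x(1)]])
  next
    show "set_integrable lborel {0<..<1} (\<lambda>x. x * avg_density b c x)"
      by (rule avg_density_first_moment_integrable)
    show "(H \<longlongrightarrow> H 1) (at_left 1)"
      using DERIV_isCont[OF H'[of 1]] by (simp add: isCont_def filterlim_at_split)
    \<comment> \<open>At 0 the first part of \<open>H\<close> is at most of order x powr (1-c) and
      vanishes; the second tends to the complete Gamma value.\<close>
    have "((\<lambda>x. x\<^sup>2 * avg_density b c x / 2) \<longlongrightarrow> 0) (at_right 0)"
    proof (rule Lim_null_comparison)
      show "\<forall>\<^sub>F x in at_right 0. norm (x\<^sup>2 * avg_density b c x / 2) \<le> x\<^sup>2 * (x powr (- c - 1) * exp (- b * x)) / 2"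
        using eventually_at_right_less[of 0]
        by eventually_elim (use avg_density_le avg_density_nonneg in \<open>auto simp: abs_mult intro!: mult_left_mono\<close>)
      show "((\<lambda>x. x\<^sup>2 * (x powr (- c - 1) * exp (- b * x)) / 2) \<longlongrightarrow> 0) (at_right 0)"
        using c b by real_asymp
    qed
    moreover have "filterlim (\<lambda>x. b * x) (at_right 0) (at_right 0)"
      using b by real_asymp
    then have "((\<lambda>x. upper_Gamma (1 - c) (b * x)) \<longlongrightarrow> Gamma (1 - c)) (at_right 0)"
      using filterlim_compose[OF upper_Gamma_tendsto_Gamma[of "1 - c"]] c by simp
    ultimately show "(H \<longlongrightarrow> 0 - (c + 1) / 2 * b powr (c - 1) * Gamma (1 - c)) (at_right 0)"
      unfolding H_def by (intro tendsto_intros)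
  qed simp
  also have "H 1 = (exp (- b) - b powr (c + 1) * upper_Gamma (- c) b) / 2 - (c + 1) / 2 * b powr (c - 1) * upper_Gamma (1 - c) b"
    by (simp add: H_def avg_density_def)
  \<comment> \<open>The recurrence brings in the parameter 2-c. Its -(1-c) and the -(c+1) from
    \<open>H\<close> add up to the coefficient -2 in the drift.\<close>
  also have "exp (- b) = b powr (c - 1) * (upper_Gamma (2 - c) b - (1 - c) * upper_Gamma (1 - c) b)"
  proof -
    have "upper_Gamma (2 - c) b = (1 - c) * upper_Gamma (1 - c) b + b powr (1 - c) * exp (- b)"
      using upper_Gamma_plus1[OF b, of "1 - c"] by simp
    moreover have "b powr (c - 1) * b powr (1 - c) = 1"
      using b by (simp flip: powr_add)
    ultimately show ?thesis by (simp add: mult.assoc[symmetric])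
  qed
  also have "b powr (c + 1) = b powr (c - 1) * b\<^sup>2"
    using b powr_add[of b "c - 1" 2] by (simp add: add.commute)
  finally have "(LBINT x:{0<..<1}. x * avg_density b c x) = b powr (c - 1) / 2 *
      ((c + 1) * Gamma (1 - c) + (upper_Gamma (2 - c) b - 2 * upper_Gamma (1 - c) b - b\<^sup>2 * upper_Gamma (- c) b))"
    by (simp add: field_simps)
  also have "b powr (c - 1) = 1 / b powr (1 - c)"
    using powr_minus_divide[of b "1 - c"] by simp
  finally have "(LBINT x:{0<..<1}. x * avg_density b c x) = 1 / b powr (1 - c) / 2 * ((c + 1) * (Gamma (1 - c) +
      (upper_Gamma (2 - c) b - 2 * upper_Gamma (1 - c) b - b\<^sup>2 * upper_Gamma (- c) b) / (c + 1)))"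
    using c by (simp add: distrib_left)
  then show ?thesis by simp
qed

end

section \<open>Riemann sums and continuous logarithms\<close>

text \<open>By uniform continuity \<open>f\<close> stays within \<open>e\<close> of its right
  endpoint value on each cell, so linearising \<open>F\<close> there costs at most e/n; the
  increments of \<open>F\<close> telescope.\<close>

lemma riemann_sum_tendsto:
  fixes F f :: "real \<Rightarrow> 'a::real_normed_vector"
  assumes F: "\<And>x. x \<in> {0..1} \<Longrightarrow> (F has_vector_derivative f x) (at x within {0..1})"
    and f: "continuous_on {0..1} f"
  shows "(\<lambda>n. (1 / real n) *\<^sub>R (\<Sum>k<n. f (real (Suc k) / real n))) \<longlonglongrightarrow> F 1 - F 0"
proof (rule LIMSEQ_I)
  fix r :: real assume "0 < r"
  define e where "e = r / 2"
  have e: "0 < e" "e < r" using \<open>0 < r\<close> by (auto simp: e_def)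
  have "uniformly_continuous_on {0..1} f"
    using f by (intro compact_uniformly_continuous) auto
  then obtain d where d: "0 < d" "\<And>x y. x \<in> {0..1} \<Longrightarrow> y \<in> {0..1} \<Longrightarrow> dist y x < d \<Longrightarrow> dist (f y) (f x) < e"
    unfolding uniformly_continuous_on_def using e by metis
  obtain N where N: "1 / d < real N" using reals_Archimedean2 by blast
  show "\<exists>N. \<forall>n\<ge>N. norm ((1 / real n) *\<^sub>R (\<Sum>k<n. f (real (Suc k) / real n)) - (F 1 - F 0)) < r"
  proof (intro exI allI impI)
    fix n assume "Suc N \<le> n"
    then have "1 / d < real n" "0 < real n" using N by auto
    then have n: "0 < real n" "1 / real n < d" using d by (auto simp: field_simps)
    define x where "x k = real k / real n" for k
    have x: "x k \<le> x (Suc k)" "x (Suc k) - x k = 1 / real n" for k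
      using n by (auto simp: x_def field_simps)
    have step: "norm (F (x (Suc k)) - F (x k) - (1 / real n) *\<^sub>R f (x (Suc k))) \<le> (1 / real n) * e" if k: "k < n" for k
    proof -
      have sub: "{x k..x (Suc k)} \<subseteq> {0..1}"
        using k n by (auto simp: x_def field_simps)
      have "norm (F (x (Suc k)) - F (x k) - (x (Suc k) - x k) *\<^sub>R f (x (Suc k))) \<le> norm (x (Suc k) - x k) * e"
      proof (rule vector_differentiable_bound_linearization)
        show "(F has_vector_derivative f y) (at y within {x k..x (Suc k)})" if "y \<in> {x k..x (Suc k)}" for y
          using F sub that by (blast intro: has_vector_derivative_within_subset)
        show "closed_segment (x k) (x (Suc k)) \<subseteq> {x k..x (Suc k)}"
          using x(1)[of k] by (simp add: closed_segment_eq_real_ivl)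
        show "norm (f y - f (x (Suc k))) \<le> e" if "y \<in> {x k..x (Suc k)}" for y
        proof -
          have "dist y (x (Suc k)) \<le> x (Suc k) - x k" using that by (auto simp: dist_real_def)
          also have "\<dots> < d" using x(2) n by simp
          finally have "dist (f y) (f (x (Suc k))) < e"
            using sub that x(1)[of k] by (intro d(2)) auto
          then show ?thesis by (simp add: dist_norm)
        qed
        show "x (Suc k) \<in> {x k..x (Suc k)}" using x(1) by simp
      qed
      then show ?thesis using x(2)[of k] n by simp
    qed
    have "F 1 - F 0 = F (x n) - F (x 0)" using n by (simp add: x_def)
    also have "\<dots> = (\<Sum>k<n. F (x (Suc k)) - F (x k))"
      by (rule sum_lessThan_telescope[of "\<lambda>k. F (x k)", symmetric])
    finally have "(1 / real n) *\<^sub>R (\<Sum>k<n. f (x (Suc k))) - (F 1 - F 0)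
        = - (\<Sum>k<n. F (x (Suc k)) - F (x k) - (1 / real n) *\<^sub>R f (x (Suc k)))"
      by (simp add: sum_subtractf scaleR_sum_right)
    also have "norm \<dots> \<le> (\<Sum>k<n. (1 / real n) * e)"
      unfolding norm_minus_cancel using step by (intro sum_norm_le) auto
    also have "\<dots> = e" using n by simp
    finally show "norm ((1 / real n) *\<^sub>R (\<Sum>k<n. f (real (Suc k) / real n)) - (F 1 - F 0)) < r"
      using e by (simp add: x_def)
  qed
qed

lemma mono_on_set_integrable:
  fixes f :: "real \<Rightarrow> real"
  assumes "mono_on {a..b} f"
  shows "set_integrable lborel {a..b} f"
proof -
  have "f \<in> borel_measurable (restrict_space borel {a..b})"
    using assms by (rule borel_measurable_mono_on_fnc)
  then have meas: "set_borel_measurable lborel {a..b} f"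
    by (simp add: set_borel_measurable_def borel_measurable_restrict_space_iff mult.commute)
  show ?thesis
  proof (rule set_integrable_bound[OF _ meas])
    show "set_integrable lborel {a..b} (\<lambda>_. max \<bar>f a\<bar> \<bar>f b\<bar>)"
      unfolding set_integrable_def
      by (intro integrable_scaleR_left integrable_real_indicator) (auto simp: emeasure_lborel_Icc_eq)
    show "AE x in lborel. x \<in> {a..b} \<longrightarrow> norm (f x) \<le> norm (max \<bar>f a\<bar> \<bar>f b\<bar>)"
    proof (intro AE_I2 impI)
      fix x assume x: "x \<in> {a..b}"
      then have "f a \<le> f x" "f x \<le> f b"
        using assms by (auto simp: mono_on_def)
      then show "norm (f x) \<le> norm (max \<bar>f a\<bar> \<bar>f b\<bar>)" by auto
    qed
  qed
qed

lemma mono_on_integral_bounds: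
  fixes f :: "real \<Rightarrow> real"
  assumes mono: "mono_on {0..} f" and h: "0 \<le> h"
  shows "h * (\<Sum>k<n. f (real k * h)) \<le> integral {0..real n * h} f"
    and "integral {0..real n * h} f \<le> h * (\<Sum>k<n. f (real (Suc k) * h))"
proof -
  have int: "f integrable_on {x..y}" if "0 \<le> x" for x y
    by (intro integrable_on_mono_on mono_on_subset[OF mono]) (use that in auto)
  have "h * (\<Sum>k<n. f (real k * h)) \<le> integral {0..real n * h} f \<and>
      integral {0..real n * h} f \<le> h * (\<Sum>k<n. f (real (Suc k) * h))"
  proof (induction n)
    case (Suc n)
    define x y where "x = real n * h" and "y = real (Suc n) * h"
    have xy: "0 \<le> x" "x \<le> y" "y - x = h" using h by (auto simp: x_def y_def algebra_simps)
    have split: "integral {0..y} f = integral {0..x} f + integral {x..y} f"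
      using xy int by (intro Henstock_Kurzweil_Integration.integral_combine[symmetric]) auto
    have "integral {x..y} (\<lambda>_. f x) \<le> integral {x..y} f"
      using xy int mono by (intro integral_le) (auto simp: mono_on_def)
    moreover have "integral {x..y} f \<le> integral {x..y} (\<lambda>_. f y)"
      using xy int mono by (intro integral_le) (auto simp: mono_on_def)
    ultimately have "h * f x \<le> integral {x..y} f" "integral {x..y} f \<le> h * f y"
      using xy by auto
    with Suc split show ?case
      unfolding x_def y_def by (simp add: distrib_left)
  qed simp
  then show "h * (\<Sum>k<n. f (real k * h)) \<le> integral {0..real n * h} f"
    and "integral {0..real n * h} f \<le> h * (\<Sum>k<n. f (real (Suc k) * h))" by auto
qed

text \<open>Abel summation: the increment over cell \<open>k\<close> is contained in the last n-k
  values. It turns a sum of dependent path values into a weighted sum of independent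
  increments.\<close>

lemma sum_Suc_eq_weighted_increments:
  fixes x :: "nat \<Rightarrow> real"
  shows "(\<Sum>k<n. x (Suc k)) = real n * x 0 + (\<Sum>k<n. real (n - k) * (x (Suc k) - x k))"
proof (induction n)
  case (Suc n)
  have "(\<Sum>k<Suc n. real (Suc n - k) * (x (Suc k) - x k)) =
      (\<Sum>k<Suc n. real (n - k) * (x (Suc k) - x k) + (x (Suc k) - x k))"
    by (intro sum.cong) (auto simp: Suc_diff_le algebra_simps)
  also have "\<dots> = (\<Sum>k<n. real (n - k) * (x (Suc k) - x k)) + (x (Suc n) - x 0)"
    using sum_lessThan_telescope[of x n] by (simp add: sum.distrib)
  finally show ?case using Suc by (simp add: algebra_simps)
qed simp

section \<open>Uniqueness of continuous logarithms\<close>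

lemma is_continuous_log_unique:
  assumes D: "connected D" "0 \<in> D" and L: "is_continuous_log D f L" "is_continuous_log D f L'" and u: "u \<in> D"
  shows "L u = L' u"
proof -
  define g where "g = (\<lambda>u. L u - L' u)"
  have cont: "continuous_on D g"
    unfolding g_def using L by (intro continuous_intros) (auto simp: is_continuous_log_def)
  have g: "\<exists>n::int. g u = 2 * of_int n * of_real pi * \<i>" if "u \<in> D" for u
  proof -
    have "exp (L u) = exp (L' u)" using L that by (auto simp: is_continuous_log_def)
    then show ?thesis unfolding exp_eq g_def by (auto simp: algebra_simps)
  qed
  \<comment> \<open>The values of \<open>g\<close> lie in 2 pi i times the integers, so distinct
    ones are at least 2 pi apart and continuity on a connected set leaves only one.\<close>
  have "g constant_on D"
  proof (rule continuous_discrete_range_constant[OF D(1) cont])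
    fix x assume x: "x \<in> D"
    show "\<exists>e>0. \<forall>y. y \<in> D \<and> g y \<noteq> g x \<longrightarrow> e \<le> norm (g y - g x)"
    proof (intro exI[of _ "2 * pi"] conjI allI impI)
      fix y assume y: "y \<in> D \<and> g y \<noteq> g x"
      obtain n m :: int where n: "g y = 2 * of_int n * of_real pi * \<i>" "g x = 2 * of_int m * of_real pi * \<i>"
        using g x y by metis
      have "g y - g x = of_int (n - m) * (2 * of_real pi * \<i>)" by (simp add: n algebra_simps)
      then have "norm (g y - g x) = \<bar>of_int (n - m)\<bar> * (2 * pi)"
        by (simp add: norm_mult del: of_int_diff)
      moreover have "1 \<le> \<bar>real_of_int (n - m)\<bar>"
        using y n by (auto simp flip: of_int_abs)
      ultimately show "2 * pi \<le> norm (g y - g x)"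
        using mult_right_mono[of 1 "\<bar>real_of_int (n - m)\<bar>" "2 * pi"] by simp
    qed simp
  qed
  then have "g u = g 0" using D u by (auto simp: constant_on_def)
  then show ?thesis using L by (simp add: g_def is_continuous_log_def)
qed

lemma continuous_log_eq:
  assumes "connected D" "0 \<in> D" "is_continuous_log D f L" "u \<in> D"
  shows "continuous_log D f u = L u"
  unfolding continuous_log_def
proof (rule the_equality)
  show "\<exists>L'. is_continuous_log D f L' \<and> L u = L' u"
    using assms by blast
  show "z = L u" if "\<exists>L. is_continuous_log D f L \<and> z = L u" for z
    using that is_continuous_log_unique[OF assms(1,2) _ assms(3,4)] by blast
qed

text \<open>One majorant for both signs of Re u. It is applied with \<open>y\<close> an average of a
  nonnegative nondecreasing path and \<open>x\<close> its terminal value.\<close>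

lemma norm_exp_uminus_mult_le:
  fixes u :: complex and x y :: real
  assumes "0 \<le> y" "y \<le> x"
  shows "norm (exp (- u * complex_of_real y)) \<le> 1 + norm (exp (- u * complex_of_real x))"
proof (cases "0 \<le> Re u")
  case True
  then have "norm (exp (- u * complex_of_real y)) \<le> 1" using assms by simp
  then show ?thesis by (simp add: add_increasing2)
next
  case False
  then have "Re u * x \<le> Re u * y" using assms by (intro mult_left_mono_neg) auto
  then show ?thesis by (simp add: add_increasing)
qed

section \<open>Time averages of subordinators\<close>

context subordinator
begin

lemma mono_path: "\<omega> \<in> space M \<Longrightarrow> 0 \<le> r \<Longrightarrow> r \<le> s \<Longrightarrow> X r \<omega> \<le> X s \<omega>"
  using nondecreasing by (auto simp: mono_on_def)

definition riemann_average :: "nat \<Rightarrow> real \<Rightarrow> 'a \<Rightarrow> real" where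
  "riemann_average n t \<omega> = (\<Sum>k<n. X (real (Suc k) * (t / real n)) \<omega>) / real n"

lemma time_average_eq_integral:
  assumes "\<omega> \<in> space M" "0 < t"
  shows "time_average X t \<omega> = integral {0..t} (\<lambda>s. X s \<omega>) / t"
proof -
  have "set_integrable lborel {0..t} (\<lambda>s. X s \<omega>)"
    using nondecreasing[OF assms(1)] by (intro mono_on_set_integrable) (rule mono_on_subset, auto)
  then show ?thesis
    using assms by (simp add: time_average_def set_borel_integral_eq_integral)
qed

lemma time_average_bounds:
  assumes \<omega>: "\<omega> \<in> space M" and t: "0 < t" and n: "0 < n"
  shows "(\<Sum>k<n. X (real k * (t / real n)) \<omega>) / real n \<le> time_average X t \<omega>"
    and "time_average X t \<omega> \<le> riemann_average n t \<omega>"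
proof -
  have "0 \<le> t / real n" "real n * (t / real n) = t" using t n by auto
  with mono_on_integral_bounds[OF nondecreasing[OF \<omega>], of "t / real n" n]
  have "t * ((\<Sum>k<n. X (real k * (t / real n)) \<omega>) / real n) \<le> t * time_average X t \<omega>"
    "t * time_average X t \<omega> \<le> t * riemann_average n t \<omega>"
    using t by (simp_all add: time_average_eq_integral[OF \<omega> t] riemann_average_def)
  then show "(\<Sum>k<n. X (real k * (t / real n)) \<omega>) / real n \<le> time_average X t \<omega>"
    and "time_average X t \<omega> \<le> riemann_average n t \<omega>"
    using t by (simp_all only: mult_le_cancel_left_pos)
qed

text \<open>The time average lies between the left and right sums, whose difference telescopes to (X
  t - X 0)/n on every path.\<close>

lemma riemann_average_tendsto:
  assumes \<omega>: "\<omega> \<in> space M" and t: "0 < t"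
  shows "(\<lambda>n. riemann_average n t \<omega>) \<longlonglongrightarrow> time_average X t \<omega>"
proof (rule tendsto_sandwich)
  show "\<forall>\<^sub>F n in sequentially. time_average X t \<omega> \<le> riemann_average n t \<omega>"
    using eventually_gt_at_top[of 0] by eventually_elim (rule time_average_bounds[OF \<omega> t])
  show "\<forall>\<^sub>F n in sequentially. riemann_average n t \<omega> \<le> time_average X t \<omega> + (X t \<omega> - X 0 \<omega>) / real n"
    using eventually_gt_at_top[of 0]
  proof eventually_elim
    case (elim n)
    have "(\<Sum>k<n. X (real (Suc k) * (t / real n)) \<omega>) - (\<Sum>k<n. X (real k * (t / real n)) \<omega>) = X t \<omega> - X 0 \<omega>"
      using sum_lessThan_telescope[of "\<lambda>k. X (real k * (t / real n)) \<omega>" n] elim by (simp add: sum_subtractf)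
    then have "(\<Sum>k<n. X (real (Suc k) * (t / real n)) \<omega>) = (\<Sum>k<n. X (real k * (t / real n)) \<omega>) + (X t \<omega> - X 0 \<omega>)"
      by linarith
    then have "riemann_average n t \<omega> = (\<Sum>k<n. X (real k * (t / real n)) \<omega>) / real n + (X t \<omega> - X 0 \<omega>) / real n"
      by (simp only: riemann_average_def add_divide_distrib)
    with time_average_bounds(1)[OF \<omega> t elim] show ?case by simp
  qed
  have "(\<lambda>n. time_average X t \<omega> + (X t \<omega> - X 0 \<omega>) / real n) \<longlonglongrightarrow> time_average X t \<omega> + 0"
    by (intro tendsto_intros lim_const_over_n)
  then show "(\<lambda>n. time_average X t \<omega> + (X t \<omega> - X 0 \<omega>) / real n) \<longlonglongrightarrow> time_average X t \<omega>" by simp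
qed simp

lemma measurable_riemann_average:
  assumes "0 \<le> t"
  shows "riemann_average n t \<in> borel_measurable M"
  unfolding riemann_average_def using assms by (intro borel_measurable_divide borel_measurable_sum measurable_X) auto

text \<open>Each Riemann average involves finitely many X s, so the pathwise limit is measurable
  without any joint measurability in time and sample point.\<close>

lemma measurable_time_average:
  assumes "0 \<le> t"
  shows "time_average X t \<in> borel_measurable M"
proof (cases "t = 0")
  case True
  then show ?thesis by (simp add: time_average_def[abs_def])
next
  case False
  with assms show ?thesis
    by (intro borel_measurable_LIMSEQ_real[OF riemann_average_tendsto] measurable_riemann_average) auto
qed

lemma riemann_average_le:
  assumes \<omega>: "\<omega> \<in> space M" "X 0 \<omega> = 0" and t: "0 \<le> t" and n: "0 < n"
  shows "0 \<le> riemann_average n t \<omega>" "riemann_average n t \<omega> \<le> X t \<omega>"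
proof -
  have *: "0 \<le> X (real (Suc k) * (t / real n)) \<omega>" "X (real (Suc k) * (t / real n)) \<omega> \<le> X t \<omega>" if "k < n" for k
  proof -
    have "real (Suc k) * t \<le> real n * t"
      using that t by (intro mult_right_mono) auto
    then have "real (Suc k) * (t / real n) \<le> t"
      using n by (simp add: field_simps)
    then show "X (real (Suc k) * (t / real n)) \<omega> \<le> X t \<omega>"
      using \<omega> t by (intro mono_path) auto
    have "X 0 \<omega> \<le> X (real (Suc k) * (t / real n)) \<omega>"
      using \<omega> t by (intro mono_path) auto
    then show "0 \<le> X (real (Suc k) * (t / real n)) \<omega>" using \<omega> by simp
  qed
  then show "0 \<le> riemann_average n t \<omega>"
    unfolding riemann_average_def by (intro divide_nonneg_nonneg sum_nonneg) auto
  have "(\<Sum>k<n. X (real (Suc k) * (t / real n)) \<omega>) \<le> of_nat (card {..<n}) * X t \<omega>"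
    using * by (intro sum_bounded_above) auto
  then show "riemann_average n t \<omega> \<le> X t \<omega>"
    using n by (simp add: riemann_average_def field_simps)
qed

lemma time_average_le:
  assumes \<omega>: "\<omega> \<in> space M" "X 0 \<omega> = 0" and t: "0 < t"
  shows "0 \<le> time_average X t \<omega>" "time_average X t \<omega> \<le> X t \<omega>"
proof -
  \<comment> \<open>With a single cell the left sum is X 0 = 0 and the right sum is X t.\<close>
  show "0 \<le> time_average X t \<omega>"
    using time_average_bounds(1)[OF \<omega>(1) t, of 1] \<omega> by simp
  show "time_average X t \<omega> \<le> X t \<omega>"
    using time_average_bounds(2)[OF \<omega>(1) t, of 1] \<omega> by (simp add: riemann_average_def)
qed

text \<open>In the left sum over n+1 cells the first term is 0 and the other n are at least the
  value at the end of the first cell. The small time t/(n+1) does no harm, because exponential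
  moments of X s beyond \<open>b\<close> are infinite for every s > 0; what matters is a factor
  close to 1.\<close>

lemma time_average_ge:
  assumes \<omega>: "\<omega> \<in> space M" "X 0 \<omega> = 0" and t: "0 < t"
  shows "(1 - 1 / real (Suc n)) * X (t / real (Suc n)) \<omega> \<le> time_average X t \<omega>"
proof -
  define h where "h = t / real (Suc n)"
  have h: "0 \<le> h" using t by (simp add: h_def)
  have "real n * X h \<omega> = (\<Sum>k<n. X h \<omega>)" by simp
  also have "\<dots> \<le> (\<Sum>k<n. X (real (Suc k) * h) \<omega>)"
    using \<omega> h by (intro sum_mono mono_path) (auto simp: algebra_simps)
  also have "\<dots> = (\<Sum>k<Suc n. X (real k * h) \<omega>)"
    using \<omega> by (simp add: sum.lessThan_Suc_shift del: sum.lessThan_Suc)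
  finally have "real n * X h \<omega> / real (Suc n) \<le> (\<Sum>k<Suc n. X (real k * h) \<omega>) / real (Suc n)"
    by (intro divide_right_mono) auto
  also have "\<dots> \<le> time_average X t \<omega>"
    using time_average_bounds(1)[OF \<omega>(1) t, of "Suc n"] by (simp add: h_def)
  also have "real n * X h \<omega> / real (Suc n) = (1 - 1 / real (Suc n)) * X h \<omega>"
    by (simp add: field_simps)
  finally show ?thesis by (simp add: h_def)
qed

end

section \<open>Laplace transform of the time average on the open half-plane\<close>

context tempered_stable_subordinator
begin

lemma integrable_exp_X:
  assumes "0 \<le> t" "- b < Re u"
  shows "integrable M (\<lambda>\<omega>. exp (- u * of_real (X t \<omega>)))"
  using laplace_domain_X[OF assms] by (simp add: laplace_domain_def)

lemma laplace_transform_riemann_average: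
  assumes b: "0 < b" and t: "0 < t" and u: "- b < Re u" and n: "0 < n"
  shows "laplace_transform M (riemann_average n t) u =
    exp (of_real (a * t * Gamma (- c)) * ((1 / real n) *\<^sub>R
      (\<Sum>k<n. (of_real b + u * of_real (real (Suc k) / real n)) powr of_real c - of_real (b powr c))))"
proof -
  define h where "h = t / real n"
  have h: "0 < h" using t n by (simp add: h_def)
  define Z where "Z k \<omega> = X (real (Suc k) * h) \<omega> - X (real k * h) \<omega>" for k \<omega>
  define w where "w k = real (n - k) / real n" for k
  have w: "0 \<le> w k" "w k \<le> 1" for k using n by (auto simp: w_def)
  \<comment> \<open>The point lies on the segment from 0 to \<open>u\<close>, and both ends belong
    to the half-plane.\<close>
  have uw: "- b < Re (u * of_real (w k))" for k
  proof (cases "0 \<le> Re u")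
    case True
    then have "0 \<le> Re u * w k" using w by simp
    then show ?thesis using b by simp
  next
    case False
    then have "Re u * 1 \<le> Re u * w k" using w by (intro mult_left_mono_neg) auto
    then show ?thesis using u by simp
  qed
  have indep: "indep_vars (\<lambda>_. borel) Z {..<n}"
    unfolding Z_def using h by (intro indep_increments[where \<tau> = "\<lambda>i. real i * h"]) auto
  have distr: "distr M borel (Z k) = distr M borel (X h)" for k
    using stationary_increments[of "real k * h" "real (Suc k) * h"] h
    by (simp add: Z_def[abs_def] algebra_simps)
  have measZ: "Z k \<in> borel_measurable M" for k
    unfolding Z_def using h by (intro borel_measurable_diff measurable_X) auto
  have intZ: "integrable M (\<lambda>\<omega>. exp (- (u * of_real (w k)) * of_real (Z k \<omega>)))" for k
  proof -
    have "integrable (distr M borel (X h)) (\<lambda>x. exp (- (u * of_real (w k)) * of_real x))"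
      using integrable_exp_X[OF _ uw[of k], of h] h
      by (subst integrable_distr_eq) (auto intro: measurable_X)
    then show ?thesis
      unfolding distr[of k, symmetric] using measZ by (subst (asm) integrable_distr_eq) auto
  qed
  have LZ: "(\<integral>\<omega>. exp (- (u * of_real (w k)) * of_real (Z k \<omega>)) \<partial>M) =
      exp (of_real (a * h * Gamma (- c)) * ((of_real b + u * of_real (w k)) powr of_real c - of_real (b powr c)))" for k
  proof -
    have "(\<integral>\<omega>. exp (- (u * of_real (w k)) * of_real (Z k \<omega>)) \<partial>M) =
        (\<integral>x. exp (- (u * of_real (w k)) * of_real x) \<partial>distr M borel (Z k))"
      using measZ by (subst integral_distr) auto
    also have "\<dots> = laplace_transform M (X h) (u * of_real (w k))"
      unfolding distr laplace_transform_def using h measurable_X[of h] by (subst integral_distr) auto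
    finally show ?thesis using laplace_transform_X[OF _ uw, of h k] h by simp
  qed
  \<comment> \<open>Only almost surely: Abel summation leaves a term in X 0.\<close>
  have "AE \<omega> in M. exp (- u * of_real (riemann_average n t \<omega>)) =
      (\<Prod>k<n. exp (- (u * of_real (w k)) * of_real (Z k \<omega>)))"
    using start_zero
  proof eventually_elim
    case (elim \<omega>)
    have "riemann_average n t \<omega> = (\<Sum>k<n. w k * Z k \<omega>)"
      using sum_Suc_eq_weighted_increments[of "\<lambda>k. X (real k * h) \<omega>" n] elim
      by (simp add: riemann_average_def h_def w_def Z_def sum_divide_distrib)
    then show ?case
      by (simp add: exp_sum [symmetric] sum_distrib_left sum_negf mult_ac)
  qed
  then have "laplace_transform M (riemann_average n t) u =
      (\<integral>\<omega>. (\<Prod>k<n. exp (- (u * of_real (w k)) * of_real (Z k \<omega>))) \<partial>M)"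
    unfolding laplace_transform_def using measZ measurable_riemann_average[of t n] t
    by (intro integral_cong_AE) auto
  also have "\<dots> = (\<Prod>k<n. \<integral>\<omega>. exp (- (u * of_real (w k)) * of_real (Z k \<omega>)) \<partial>M)"
    by (intro indep_vars_lebesgue_integral indep_vars_compose2[OF indep] intZ) auto
  also have "\<dots> = exp (\<Sum>k<n. of_real (a * h * Gamma (- c)) *
      ((of_real b + u * of_real (w k)) powr of_real c - of_real (b powr c)))"
    by (simp only: LZ exp_sum finite_lessThan)
  also have "(\<Sum>k<n. of_real (a * h * Gamma (- c)) *
        ((of_real b + u * of_real (w k)) powr of_real c - of_real (b powr c))) =
      of_real (a * h * Gamma (- c)) * (\<Sum>k<n. (of_real b + u * of_real (w k)) powr of_real c - of_real (b powr c))"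
    by (simp only: sum_distrib_left)
  \<comment> \<open>Reversing the order of summation turns the weights (n-k)/n into (k+1)/n, the
    right endpoints of the Riemann sum.\<close>
  also have "(\<Sum>k<n. (of_real b + u * of_real (w k)) powr of_real c - of_real (b powr c)) =
      (\<Sum>k<n. (of_real b + u * of_real (real (Suc k) / real n)) powr of_real c - of_real (b powr c))"
    by (subst sum.nat_diff_reindex[symmetric]) (auto intro!: sum.cong simp: w_def Suc_diff_Suc)
  finally show ?thesis
    by (simp add: h_def scaleR_conv_of_real mult_ac)
qed

lemma laplace_time_average_interior:
  assumes b: "0 < b" and c: "0 < c" "c < 1" and t: "0 < t" and u: "- b < Re u"
  shows "u \<in> laplace_domain M (time_average X t)"
    and "laplace_transform M (time_average X t) u = exp (of_real (t * (a / (c + 1))) * avg_exponent b c u)"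
proof -
  have dom: "integrable M (\<lambda>\<omega>. 1 + norm (exp (- u * of_real (X t \<omega>))))"
    using integrable_exp_X[of t u] t u by (intro Bochner_Integration.integrable_add integrable_norm) auto
  have lim: "AE \<omega> in M. (\<lambda>n. exp (- u * of_real (riemann_average (Suc n) t \<omega>))) \<longlonglongrightarrow> exp (- u * of_real (time_average X t \<omega>))"
    using riemann_average_tendsto t by (intro AE_I2 tendsto_intros LIMSEQ_Suc) auto
  have bound: "AE \<omega> in M. norm (exp (- u * of_real (riemann_average (Suc n) t \<omega>))) \<le> 1 + norm (exp (- u * of_real (X t \<omega>)))" for n
    using start_zero AE_space
    by eventually_elim (use riemann_average_le t in \<open>intro norm_exp_uminus_mult_le, auto\<close>)
  have [measurable]: "time_average X t \<in> borel_measurable M" "riemann_average n t \<in> borel_measurable M" for n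
    using measurable_time_average[of t] measurable_riemann_average[of t] t by auto
  have meas: "(\<lambda>\<omega>. exp (- u * of_real (time_average X t \<omega>))) \<in> borel_measurable M"
    "(\<lambda>\<omega>. exp (- u * of_real (riemann_average (Suc n) t \<omega>))) \<in> borel_measurable M" for n
    by measurable
  show "u \<in> laplace_domain M (time_average X t)"
    using integrable_dominated_convergence[OF meas dom lim bound] by (simp add: laplace_domain_def)
  have conv: "(\<lambda>n. laplace_transform M (riemann_average (Suc n) t) u) \<longlonglongrightarrow> laplace_transform M (time_average X t) u"
    unfolding laplace_transform_def by (rule integral_dominated_convergence[OF meas dom lim bound])
  show "laplace_transform M (time_average X t) u = exp (of_real (t * (a / (c + 1))) * avg_exponent b c u)"
  proof (cases "u = 0")
    case True
    then show ?thesis using b c by (simp add: laplace_transform_def prob_space)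
  next
    case False
    have c1: "complex_of_real (c + 1) \<noteq> 0" using c unfolding of_real_eq_0_iff by simp
    \<comment> \<open>An explicit primitive of \<open>f\<close>; the division by \<open>u\<close> is
      why u = 0 is treated apart. Multiplying F 1 - F 0 by (c+1) u reproduces the bracket in
      \<open>times_avg_exponent\<close>.\<close>
    define F where "F y = (of_real b + u * of_real y) powr of_real (c + 1) / (of_real (c + 1) * u) - of_real (b powr c) * of_real y" for y :: real
    define f where "f y = (of_real b + u * of_real y) powr of_real c - of_real (b powr c)" for y :: real
    have Re_pos: "0 < b + Re u * y" if "y \<in> {0..1}" for y
    proof (cases "0 \<le> Re u")
      case True
      then show ?thesis using b that by (simp add: add_pos_nonneg)
    next
      case False
      then have "Re u * 1 \<le> Re u * y" using that by (intro mult_left_mono_neg) auto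
      then show ?thesis using u by simp
    qed
    have pos: "of_real b + u * of_real y \<notin> \<real>\<^sub>\<le>\<^sub>0" if "y \<in> {0..1}" for y
      using Re_pos[OF that] by (auto simp: complex_nonpos_Reals_iff)
    have "(F has_vector_derivative f y) (at y within {0..1})" if "y \<in> {0..1}" for y
    proof -
      have "((\<lambda>z. (of_real b + u * z) powr of_real (c + 1)) has_field_derivative
          of_real (c + 1) * (of_real b + u * of_real y) powr (of_real (c + 1) - 1) * u) (at (of_real y))"
        by (rule DERIV_chain2[where f = "\<lambda>z. z powr of_real (c + 1)" and g = "\<lambda>z. of_real b + u * z",
              OF has_field_derivative_powr[OF pos[OF that], of "of_real (c + 1)"]])
           (auto intro!: derivative_eq_intros)
      then have "((\<lambda>z. (of_real b + u * z) powr of_real (c + 1) / (of_real (c + 1) * u) - of_real (b powr c) * z) has_field_derivative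
          of_real (c + 1) * (of_real b + u * of_real y) powr (of_real (c + 1) - 1) * u / (of_real (c + 1) * u)
          - of_real (b powr c) * 1) (at (of_real y))"
        by (intro DERIV_diff DERIV_cdivide DERIV_cmult DERIV_ident)
      also have "complex_of_real (c + 1) - 1 = of_real c" by simp
      also have "of_real (c + 1) * (of_real b + u * of_real y) powr of_real c * u / (of_real (c + 1) * u)
          - of_real (b powr c) * 1 = f y"
        using False c1 by (simp add: f_def del: of_real_add)
      finally show ?thesis
        unfolding F_def by (intro has_vector_derivative_real_field)
    qed
    moreover have "continuous_on {0..1} f"
      unfolding f_def using Re_pos less_imp_le[OF Re_pos] b c by (intro continuous_intros) auto
    ultimately have R: "(\<lambda>n. (1 / real n) *\<^sub>R (\<Sum>k<n. f (real (Suc k) / real n))) \<longlonglongrightarrow> F 1 - F 0"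
      by (rule riemann_sum_tendsto)
    have "(\<lambda>n. exp (of_real (a * t * Gamma (- c)) * ((1 / real (Suc n)) *\<^sub>R (\<Sum>k<Suc n. f (real (Suc k) / real (Suc n))))))
      \<longlonglongrightarrow> exp (of_real (a * t * Gamma (- c)) * (F 1 - F 0))"
      by (intro tendsto_intros LIMSEQ_Suc[OF R])
    then have "(\<lambda>n. laplace_transform M (riemann_average (Suc n) t) u) \<longlonglongrightarrow> exp (of_real (a * t * Gamma (- c)) * (F 1 - F 0))"
      by (simp only: f_def laplace_transform_riemann_average[OF b t u zero_less_Suc])
    with conv have "laplace_transform M (time_average X t) u = exp (of_real (a * t * Gamma (- c)) * (F 1 - F 0))"
      by (rule LIMSEQ_unique)
    also have "of_real (a * t * Gamma (- c)) * (F 1 - F 0) = of_real (t * (a / (c + 1))) * avg_exponent b c u"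
    proof -
      have "of_real b powr of_real (c + 1) = complex_of_real (b powr (c + 1))"
        using b powr_of_real[of b "c + 1"] by simp
      then have "(of_real (c + 1) * u) * (of_real (Gamma (- c)) * (F 1 - F 0)) = of_real (Gamma (- c)) *
        ((of_real b + u) powr of_real (c + 1) - of_real (b powr (c + 1)) - of_real (c + 1) * u * of_real (b powr c))"
        using c1 False by (simp add: F_def right_diff_distrib)
      also have "\<dots> = u * avg_exponent b c u"
        using times_avg_exponent[OF b c u] by simp
      finally have "of_real (c + 1) * (of_real (Gamma (- c)) * (F 1 - F 0)) = avg_exponent b c u"
        using False by simp
      then have "of_real (t * (a / (c + 1))) * avg_exponent b c u =
          of_real (t * (a / (c + 1))) * (of_real (c + 1) * (of_real (Gamma (- c)) * (F 1 - F 0)))"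
        by simp
      also have "\<dots> = of_real (t * (a / (c + 1)) * (c + 1)) * (of_real (Gamma (- c)) * (F 1 - F 0))"
        by (simp only: of_real_mult mult.assoc)
      also have "t * (a / (c + 1)) * (c + 1) = a * t" using c by simp
      finally show ?thesis by (simp add: mult.assoc)
    qed
    finally show ?thesis .
  qed
qed

section \<open>Exponential moments, the boundary line and the exact domain\<close>

lemma expectation_exp_X:
  assumes t: "0 \<le> t" and r: "r < b"
  shows "integrable M (\<lambda>\<omega>. exp (r * X t \<omega>))"
    and "expectation (\<lambda>\<omega>. exp (r * X t \<omega>)) = exp (a * t * Gamma (- c) * ((b - r) powr c - b powr c))"
proof -
  have u: "- b < Re (- complex_of_real r)" using r by simp
  have eq: "exp (- (- complex_of_real r) * of_real (X t \<omega>)) = of_real (exp (r * X t \<omega>))" for \<omega>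
    by (simp add: exp_of_real [symmetric])
  show int: "integrable M (\<lambda>\<omega>. exp (r * X t \<omega>))"
    using integrable_exp_X[OF t u] unfolding eq complex_of_real_integrable_eq .
  have "complex_of_real (expectation (\<lambda>\<omega>. exp (r * X t \<omega>))) = laplace_transform M (X t) (- of_real r)"
    unfolding laplace_transform_def eq by simp
  also have "\<dots> = exp (of_real (a * t * Gamma (- c)) * (of_real (b - r) powr of_real c - of_real (b powr c)))"
    using laplace_transform_X[OF t u] by simp
  also have "\<dots> = of_real (exp (a * t * Gamma (- c) * ((b - r) powr c - b powr c)))"
  proof -
    have "complex_of_real (b - r) powr of_real c = of_real ((b - r) powr c)"
      using r by (simp add: powr_of_real del: of_real_diff)
    then show ?thesis
      by (simp only: of_real_diff [symmetric] of_real_mult [symmetric] exp_of_real)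
  qed
  finally show "expectation (\<lambda>\<omega>. exp (r * X t \<omega>)) = exp (a * t * Gamma (- c) * ((b - r) powr c - b powr c))"
    by (simp only: of_real_eq_iff)
qed

text \<open>Finiteness beyond \<open>b\<close> would make the moment generating function left differentiable at \<open>b\<close>,
  but there it behaves like \<open>exp (- C * h powr c)\<close> in \<open>h = b - r\<close>, with infinite slope as \<open>c < 1\<close>.\<close>

lemma not_integrable_exp_X:
  assumes a: "0 < a" and b: "0 < b" and c: "0 < c" "c < 1" and t: "0 < t" and w: "b < w"
  shows "\<not> integrable M (\<lambda>\<omega>. exp (w * X t \<omega>))"
proof
  assume int: "integrable M (\<lambda>\<omega>. exp (w * X t \<omega>))"
  define B where "B = expectation (\<lambda>\<omega>. exp (w * X t \<omega>)) / (w - b)"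
  define C where "C = - (a * t * Gamma (- c))"
  define A where "A = exp (C * b powr c)"
  have "0 < Gamma (1 - c)" using c by (intro Gamma_real_pos) auto
  then have "Gamma (- c) < 0" using c by (simp add: Gamma_one_minus[OF c] mult_less_0_iff)
  then have C: "0 < C" using a t by (simp add: C_def mult_pos_neg)
  have A: "0 < A" by (simp add: A_def)
  have E: "expectation (\<lambda>\<omega>. exp ((b - h) * X t \<omega>)) = A * exp (- C * h powr c)" if "0 < h" for h
    using expectation_exp_X(2)[of t "b - h"] t that
    by (simp add: A_def C_def algebra_simps flip: exp_add)
  \<comment> \<open>The known formula covers only exponents below \<open>b\<close>, so the slope at
    \<open>b\<close> is approached by comparing b-k with b-h and letting \<open>k\<close> tend to 0
    afterwards.\<close>
  have ineq: "A * exp (- C * k powr c) - A * exp (- C * h powr c) \<le> h * B" if kh: "0 < k" "k < h" for k h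
  proof -
    have i: "integrable M (\<lambda>\<omega>. exp ((b - k) * X t \<omega>))" "integrable M (\<lambda>\<omega>. exp ((b - h) * X t \<omega>))"
      using expectation_exp_X(1)[of t] t kh by auto
    have "A * exp (- C * k powr c) - A * exp (- C * h powr c) =
        expectation (\<lambda>\<omega>. exp ((b - k) * X t \<omega>) - exp ((b - h) * X t \<omega>))"
      using kh by (simp add: i E Bochner_Integration.integral_diff[OF i])
    also have "\<dots> \<le> expectation (\<lambda>\<omega>. h / (w - b) * exp (w * X t \<omega>))"
    proof (rule integral_mono_AE)
      show "AE \<omega> in M. exp ((b - k) * X t \<omega>) - exp ((b - h) * X t \<omega>) \<le> h / (w - b) * exp (w * X t \<omega>)"
        using start_zero AE_space
      proof eventually_elim
        case (elim \<omega>)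
        define x where "x = X t \<omega>"
        have x: "0 \<le> x" using mono_path[of \<omega> 0 t] elim t by (simp add: x_def)
        have "exp ((b - h) * x) = exp ((b - k) * x) * exp (- ((h - k) * x))"
          by (simp add: algebra_simps flip: exp_add)
        then have "exp ((b - k) * x) - exp ((b - h) * x) = exp ((b - k) * x) * (1 - exp (- ((h - k) * x)))"
          by (simp add: algebra_simps)
        also have "\<dots> \<le> exp (b * x) * (h * x)"
        proof (rule mult_mono)
          show "exp ((b - k) * x) \<le> exp (b * x)"
            using kh x by (auto intro!: mult_right_mono)
          have "1 - exp (- ((h - k) * x)) \<le> (h - k) * x"
            using exp_ge_add_one_self[of "- ((h - k) * x)"] by linarith
          also have "\<dots> \<le> h * x" using kh x by (intro mult_right_mono) auto
          finally show "1 - exp (- ((h - k) * x)) \<le> h * x" .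
          show "0 \<le> 1 - exp (- ((h - k) * x))"
            using kh x by simp
        qed simp
        also have "\<dots> = h / (w - b) * (exp (b * x) * ((w - b) * x))"
          using w by simp
        \<comment> \<open>The assumed surplus w-b pays for the linear factor \<open>x\<close> of the
          difference quotient.\<close>
        also have "(w - b) * x \<le> exp ((w - b) * x)"
          using exp_ge_add_one_self[of "(w - b) * x"] by linarith
        then have "h / (w - b) * (exp (b * x) * ((w - b) * x)) \<le> h / (w - b) * (exp (b * x) * exp ((w - b) * x))"
          using w kh by (intro mult_left_mono) auto
        also have "exp (b * x) * exp ((w - b) * x) = exp (w * x)"
          by (simp add: algebra_simps flip: exp_add)
        finally show ?case by (simp add: x_def)
      qed
    qed (use i int in auto)
    also have "\<dots> = h * B" by (simp add: B_def)
    finally show ?thesis .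
  qed
  have "A * (1 - exp (- C * h powr c)) \<le> h * B" if h: "0 < h" for h
  proof -
    have "((\<lambda>k. k powr c) \<longlongrightarrow> 0) (at_right 0)"
      using c by real_asymp
    then have "((\<lambda>k. A * exp (- C * k powr c) - A * exp (- C * h powr c)) \<longlongrightarrow>
        A * exp (- C * 0) - A * exp (- C * h powr c)) (at_right 0)"
      by (intro tendsto_intros)
    moreover have "\<forall>\<^sub>F k in at_right 0. A * exp (- C * k powr c) - A * exp (- C * h powr c) \<le> h * B"
      using h ineq by (intro eventually_at_rightI[of 0 h]) auto
    ultimately have "A * exp (- C * 0) - A * exp (- C * h powr c) \<le> h * B"
      by (intro tendsto_upperbound) auto
    then show ?thesis by (simp add: algebra_simps)
  qed
  then have "\<forall>\<^sub>F h in at_right 0. (1 - exp (- C * h powr c)) / h \<le> B / A"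
    using A by (intro eventually_at_rightI[of 0 1]) (auto simp: field_simps)
  moreover have "filterlim (\<lambda>h. (1 - exp (- C * h powr c)) / h) at_top (at_right 0)"
    using C c by real_asymp
  then have "\<forall>\<^sub>F h in at_right 0. B / A < (1 - exp (- C * h powr c)) / h"
    by (simp add: filterlim_at_top_dense)
  ultimately have "\<forall>\<^sub>F h in at_right (0::real). False"
    by eventually_elim simp
  then show False by simp
qed

text \<open>Monotone convergence along exponents increasing to \<open>b\<close>: the expectations
  stay bounded because they equal a function of \<open>avg_exponent\<close>, which is continuous up
  to the boundary line.\<close>

lemma integrable_exp_time_average:
  assumes b: "0 < b" and c: "0 < c" "c < 1" and t: "0 < t"
  shows "integrable M (\<lambda>\<omega>. exp (b * time_average X t \<omega>))"
proof -
  define r where "r i = b - b / real (Suc i)" for i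
  have r: "r i < b" for i using b by (simp add: r_def)
  have r_mono: "r i \<le> r j" if "i \<le> j" for i j
    using that b by (auto simp: r_def intro!: divide_left_mono)
  have "r \<longlonglongrightarrow> b - 0"
    unfolding r_def by (intro tendsto_intros LIMSEQ_Suc[OF lim_const_over_n])
  then have r_lim: "r \<longlonglongrightarrow> b" by simp
  have eq: "exp (- (- complex_of_real s) * of_real (time_average X t \<omega>)) = of_real (exp (s * time_average X t \<omega>))" for s \<omega>
    by (simp add: exp_of_real [symmetric])
  have u: "- b < Re (- complex_of_real (r i))" for i using r by simp
  note interior = laplace_time_average_interior[OF b c t u]
  have int: "integrable M (\<lambda>\<omega>. exp (r i * time_average X t \<omega>))" for i
    using interior(1)[of i] unfolding laplace_domain_def mem_Collect_eq eq complex_of_real_integrable_eq .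
  define G where "G u = exp (of_real (t * (a / (c + 1))) * avg_exponent b c u)" for u
  have val: "expectation (\<lambda>\<omega>. exp (r i * time_average X t \<omega>)) = Re (G (- of_real (r i)))" for i
    using interior(2)[of i] unfolding laplace_transform_def eq G_def by (metis Re_complex_of_real integral_complex_of_real)
  have "continuous_on {u. - b \<le> Re u} G"
    unfolding G_def by (intro continuous_intros continuous_on_avg_exponent b c)
  then have "(\<lambda>i. G (- of_real (r i))) \<longlonglongrightarrow> G (- of_real b)"
    by (rule continuous_on_tendsto_compose)
       (use r less_imp_le in \<open>auto intro!: tendsto_intros r_lim always_eventually\<close>)
  then have lim: "(\<lambda>i. expectation (\<lambda>\<omega>. exp (r i * time_average X t \<omega>))) \<longlonglongrightarrow> Re (G (- of_real b))"
    unfolding val by (rule tendsto_Re)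
  show ?thesis
  proof (rule integrable_monotone_convergence[OF int _ _ lim])
    show "AE \<omega> in M. mono (\<lambda>i. exp (r i * time_average X t \<omega>))"
      using start_zero AE_space
      by eventually_elim (auto intro!: monoI mult_right_mono r_mono time_average_le t)
    show "AE \<omega> in M. (\<lambda>i. exp (r i * time_average X t \<omega>)) \<longlonglongrightarrow> exp (b * time_average X t \<omega>)"
      by (intro AE_I2 tendsto_intros r_lim)
    have [measurable]: "time_average X t \<in> borel_measurable M"
      using measurable_time_average t by simp
    show "(\<lambda>\<omega>. exp (b * time_average X t \<omega>)) \<in> borel_measurable M"
      by measurable
  qed
qed

text \<open>The point \<open>u\<close> is approached from its right by \<open>v\<close>, inside the
  open half-plane, and \<open>exp (b * time_average X t \<omega>)\<close> majorises all the
  transforms at once.\<close>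

lemma laplace_time_average:
  assumes b: "0 < b" and c: "0 < c" "c < 1" and t: "0 < t" and u: "- b \<le> Re u"
  shows "u \<in> laplace_domain M (time_average X t)"
    and "laplace_transform M (time_average X t) u = exp (of_real (t * (a / (c + 1))) * avg_exponent b c u)"
proof -
  have [measurable]: "time_average X t \<in> borel_measurable M"
    using measurable_time_average t by simp
  define v where "v i = u + of_real (b / real (Suc i))" for i
  have v: "- b < Re (v i)" for i
  proof -
    have "0 < b / real (Suc i)" using b by simp
    then have "- b < Re u + b / real (Suc i)" using u by linarith
    then show ?thesis by (simp add: v_def del: of_nat_Suc)
  qed
  have "(\<lambda>i. u + of_real (b / real (Suc i))) \<longlonglongrightarrow> u + of_real 0"
    by (intro tendsto_intros LIMSEQ_Suc[OF lim_const_over_n])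
  then have v_lim: "v \<longlonglongrightarrow> u" by (simp add: v_def[abs_def])
  have lim: "AE \<omega> in M. (\<lambda>i. exp (- v i * of_real (time_average X t \<omega>))) \<longlonglongrightarrow> exp (- u * of_real (time_average X t \<omega>))"
    by (intro AE_I2 tendsto_intros v_lim)
  have bound: "AE \<omega> in M. norm (exp (- v i * of_real (time_average X t \<omega>))) \<le> exp (b * time_average X t \<omega>)" for i
    using start_zero AE_space
  proof eventually_elim
    case (elim \<omega>)
    have "- Re (v i) * time_average X t \<omega> \<le> b * time_average X t \<omega>"
      using v[of i] time_average_le[of \<omega> t] elim t by (intro mult_right_mono) auto
    then show ?case by simp
  qed
  have meas: "(\<lambda>\<omega>. exp (- u * of_real (time_average X t \<omega>))) \<in> borel_measurable M"
    "(\<lambda>\<omega>. exp (- v i * of_real (time_average X t \<omega>))) \<in> borel_measurable M" for i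
    by measurable
  note dom = integrable_exp_time_average[OF b c t]
  show "u \<in> laplace_domain M (time_average X t)"
    using integrable_dominated_convergence[OF meas dom lim bound] by (simp add: laplace_domain_def)
  have "(\<lambda>i. laplace_transform M (time_average X t) (v i)) \<longlonglongrightarrow> laplace_transform M (time_average X t) u"
    unfolding laplace_transform_def by (rule integral_dominated_convergence[OF meas dom lim bound])
  moreover have "(\<lambda>i. laplace_transform M (time_average X t) (v i)) \<longlonglongrightarrow>
      exp (of_real (t * (a / (c + 1))) * avg_exponent b c u)"
  proof -
    have "(\<lambda>i. avg_exponent b c (v i)) \<longlonglongrightarrow> avg_exponent b c u"
      by (rule continuous_on_tendsto_compose[OF continuous_on_avg_exponent[OF b c] v_lim])
         (use u v less_imp_le in \<open>auto intro!: always_eventually\<close>)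
    then show ?thesis
      unfolding laplace_time_average_interior(2)[OF b c t v] by (intro tendsto_intros)
  qed
  ultimately show "laplace_transform M (time_average X t) u = exp (of_real (t * (a / (c + 1))) * avg_exponent b c u)"
    by (rule LIMSEQ_unique)
qed

lemma laplace_domain_time_average:
  assumes a: "0 < a" and b: "0 < b" and c: "0 < c" "c < 1" and t: "0 < t"
  shows "laplace_domain M (time_average X t) = {u. - b \<le> Re u}"
proof (intro equalityI subsetI)
  fix u assume "u \<in> {u. - b \<le> Re u}"
  then show "u \<in> laplace_domain M (time_average X t)"
    using laplace_time_average(1)[OF b c t] by simp
next
  fix u assume u: "u \<in> laplace_domain M (time_average X t)"
  show "u \<in> {u. - b \<le> Re u}"
  proof (rule ccontr)
    define v where "v = - Re u"
    assume "u \<notin> {u. - b \<le> Re u}"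
    then have v: "b < v" by (simp add: v_def)
    have "integrable M (\<lambda>\<omega>. norm (exp (- u * of_real (time_average X t \<omega>))))"
      using u by (intro integrable_norm) (simp add: laplace_domain_def)
    then have int: "integrable M (\<lambda>\<omega>. exp (v * time_average X t \<omega>))"
      by (simp add: v_def)
    \<comment> \<open>There is room between \<open>b\<close> and \<open>v\<close>, so the loss
      factor 1 - 1/(n+1) can be chosen to keep the exponent above \<open>b\<close>.\<close>
    have "(\<lambda>n. v * (1 - 1 / real (Suc n))) \<longlonglongrightarrow> v * (1 - 0)"
      by (intro tendsto_intros LIMSEQ_Suc[OF lim_const_over_n])
    then have "\<forall>\<^sub>F n in sequentially. b < v * (1 - 1 / real (Suc n))"
      using v by (intro order_tendstoD) auto
    then obtain n where n: "b < v * (1 - 1 / real (Suc n))"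
      by (auto simp: eventually_sequentially)
    define s where "s = t / real (Suc n)"
    have s: "0 < s" using t by (simp add: s_def)
    have "integrable M (\<lambda>\<omega>. exp (v * (1 - 1 / real (Suc n)) * X s \<omega>))"
    proof (rule Bochner_Integration.integrable_bound[OF int])
      show "(\<lambda>\<omega>. exp (v * (1 - 1 / real (Suc n)) * X s \<omega>)) \<in> borel_measurable M"
        using measurable_X[of s] s by simp
      show "AE \<omega> in M. norm (exp (v * (1 - 1 / real (Suc n)) * X s \<omega>)) \<le> norm (exp (v * time_average X t \<omega>))"
        using start_zero AE_space
      proof eventually_elim
        case (elim \<omega>)
        have "v * ((1 - 1 / real (Suc n)) * X s \<omega>) \<le> v * time_average X t \<omega>"
          unfolding s_def using elim v b t by (intro mult_left_mono time_average_ge) auto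
        then show ?case by (simp add: mult.assoc del: of_nat_Suc)
      qed
    qed
    then show False
      using not_integrable_exp_X[OF a b c s n] by simp
  qed
qed

end

section \<open>The Levy triplet\<close>

text \<open>Because the first moment on (0,1) is finite, the truncation term can be integrated
  separately. It contributes \<open>u\<close> times that moment, and a drift equal to the moment
  cancels it, leaving the untruncated exponent.\<close>

lemma levy_khintchine_avg_density:
  fixes a b c :: real
  assumes a: "0 < a" and b: "0 < b" and c: "0 < c" "c < 1"
    and l_def: "l = (\<lambda>x. a / (c + 1) * avg_density b c x * indicator {0<..} x)"
    and \<nu>_def: "\<nu> = density lborel (\<lambda>x. ennreal (l x))"
  shows "l \<in> borel_measurable borel" "\<And>x. 0 \<le> l x" "levy_measure \<nu>"
    and "\<And>u. - b \<le> Re u \<Longrightarrow> set_integrable \<nu> (- {0}) (levy_khintchine_integrand u)"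
    and "\<And>u. - b \<le> Re u \<Longrightarrow> levy_khintchine_exponent (a / (c + 1) * (LBINT x:{0<..<1}. x * avg_density b c x)) 0 \<nu> u =
      of_real (a / (c + 1)) * avg_exponent b c u"
proof -
  let ?K = "a / (c + 1)"
  have K: "0 < ?K" using a c by simp
  have "(\<lambda>x. ?K * (indicator {0<..} x * avg_density b c x)) \<in> borel_measurable borel"
    using borel_measurable_avg_density[OF b c] by measurable
  then show meas [measurable]: "l \<in> borel_measurable borel"
    by (simp add: l_def mult_ac)
  show nonneg: "0 \<le> l x" for x
  proof (cases "0 < x")
    case True
    then have "0 \<le> ?K * avg_density b c x"
      using avg_density_nonneg[OF b c] K by (intro mult_nonneg_nonneg) auto
    with True show ?thesis by (simp add: l_def)
  qed (simp add: l_def)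
  have l_le: "l x \<le> ?K * (x powr (- c - 1))" if "0 < x" for x
  proof -
    have "avg_density b c x \<le> x powr (- c - 1) * exp (- b * x)"
      using avg_density_le[OF b c that] .
    also have "\<dots> \<le> x powr (- c - 1) * 1"
      using that b by (intro mult_left_mono) auto
    finally have "?K * avg_density b c x \<le> ?K * (x powr (- c - 1))"
      using K by (intro mult_left_mono) auto
    then show ?thesis using that by (simp add: l_def)
  qed
  have dom: "integrable lborel (\<lambda>x. indicator {0<..} x *\<^sub>R (?K * (min 1 x * x powr (- c - 1))))"
    using set_integrable_mult_right[OF set_integrable_min_powr[OF c], of ?K] by (simp add: set_integrable_def)
  show "levy_measure \<nu>"
    unfolding levy_measure_def
  proof (intro conjI)
    show "sets \<nu> = sets borel" by (simp add: \<nu>_def)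
    have "emeasure \<nu> {0} = (\<integral>\<^sup>+ x. ennreal (l x) * indicator {0} x \<partial>lborel)"
      unfolding \<nu>_def by (subst emeasure_density) auto
    also have "(\<lambda>x. ennreal (l x) * indicator {0} x) = (\<lambda>_. 0)"
      by (auto simp: fun_eq_iff indicator_def l_def)
    finally show "emeasure \<nu> {0} = 0" by simp
    have "(\<integral>\<^sup>+ x. ennreal (min 1 (x\<^sup>2)) \<partial>\<nu>) = (\<integral>\<^sup>+ x. ennreal (l x) * ennreal (min 1 (x\<^sup>2)) \<partial>lborel)"
      unfolding \<nu>_def by (subst nn_integral_density) auto
    also have "\<dots> \<le> (\<integral>\<^sup>+ x. ennreal (indicator {0<..} x *\<^sub>R (?K * (min 1 x * x powr (- c - 1)))) \<partial>lborel)"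
    proof (intro nn_integral_mono)
      fix x :: real
      show "ennreal (l x) * ennreal (min 1 (x\<^sup>2)) \<le> ennreal (indicator {0<..} x *\<^sub>R (?K * (min 1 x * x powr (- c - 1))))"
      proof (cases "0 < x")
        case True
        \<comment> \<open>The finite-variation bound with \<open>min 1 x\<close> is stronger than
          what a Levy measure has to satisfy.\<close>
        have "x\<^sup>2 \<le> x" if "x \<le> 1"
          using mult_left_mono[OF that, of x] True by (simp add: power2_eq_square)
        then have "min 1 (x\<^sup>2) \<le> min 1 x"
          by (cases "x \<le> 1") auto
        then have "l x * min 1 (x\<^sup>2) \<le> (?K * (x powr (- c - 1))) * min 1 x"
          using l_le[OF True] nonneg[of x] K by (intro mult_mono) auto
        then show ?thesis
          using True nonneg by (simp add: ennreal_mult[symmetric] mult_ac ennreal_leI)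
      qed (simp add: l_def)
    qed
    also have "\<dots> < \<infinity>"
      using integrableD(2)[OF dom] K by (simp add: indicator_def abs_mult less_top split: if_splits)
    finally show "(\<integral>\<^sup>+ x. ennreal (min 1 (x\<^sup>2)) \<partial>\<nu>) < \<infinity>" .
  qed
  fix u :: complex assume u: "- b \<le> Re u"
  define A where "A x = (exp (- u * of_real x) - 1) * complex_of_real (avg_density b c x)" for x
  define B where "B x = x * avg_density b c x" for x
  have intA: "set_integrable lborel {0<..} A"
    unfolding A_def by (rule avg_integrand_integrable[OF b c u])
  have intB: "set_integrable lborel {0<..<1} B"
    unfolding B_def by (rule avg_density_first_moment_integrable[OF b c])
  have eq: "l x *\<^sub>R (indicator (- {0}) x *\<^sub>R levy_khintchine_integrand u x) =
      of_real ?K * (indicator {0<..} x *\<^sub>R A x + u * of_real (indicator {0<..<1} x *\<^sub>R B x))" for x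
    by (auto simp: l_def A_def B_def levy_khintchine_integrand_def indicator_def scaleR_conv_of_real algebra_simps)
  have intB': "integrable lborel (\<lambda>x. u * complex_of_real (indicator {0<..<1} x *\<^sub>R B x))"
    using intB unfolding set_integrable_def by (intro integrable_mult_right integrable_of_real)
  have int: "integrable lborel (\<lambda>x. l x *\<^sub>R (indicator (- {0}) x *\<^sub>R levy_khintchine_integrand u x))"
    unfolding eq using Bochner_Integration.integrable_add[OF intA[unfolded set_integrable_def] intB']
    by (rule integrable_mult_right)
  have lk_meas: "(\<lambda>x. indicator (- {0}) x *\<^sub>R levy_khintchine_integrand u x) \<in> borel_measurable lborel"
    unfolding levy_khintchine_integrand_def by measurable
  show "set_integrable \<nu> (- {0}) (levy_khintchine_integrand u)"
    unfolding set_integrable_def \<nu>_def using int nonneg lk_meas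
    by (subst integrable_density) auto
  have "(LINT x:- {0}|\<nu>. levy_khintchine_integrand u x) =
      (LBINT x. l x *\<^sub>R (indicator (- {0}) x *\<^sub>R levy_khintchine_integrand u x))"
    unfolding set_lebesgue_integral_def \<nu>_def using nonneg lk_meas
    by (subst integral_density) auto
  also have "\<dots> = of_real ?K * ((LBINT x:{0<..}. A x) + u * of_real (LBINT x:{0<..<1}. B x))"
    unfolding eq using intA intB' intB unfolding set_integrable_def set_lebesgue_integral_def
    by (simp only: integral_mult_right_zero Bochner_Integration.integral_add integral_complex_of_real)
  also have "(LBINT x:{0<..}. A x) = avg_exponent b c u"
    by (simp add: A_def avg_exponent_def)
  finally show "levy_khintchine_exponent (?K * (LBINT x:{0<..<1}. x * avg_density b c x)) 0 \<nu> u =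
      of_real ?K * avg_exponent b c u"
    by (simp add: levy_khintchine_exponent_def B_def algebra_simps)
qed

text \<open>The existence of a logarithm and the integrability clause certify that neither the
  definite description nor the Bochner integral falls back on a default value. Integrability is
  claimed for t > 0 only: at t = 0 the domain is the whole plane, and the factor t makes the
  right-hand side 0.\<close>

theorem corollary1:
  fixes M :: "'a measure" and X :: "real \<Rightarrow> 'a \<Rightarrow> real" and a b c :: real
    and \<alpha> \<beta> :: real and l :: "real \<Rightarrow> real" and \<nu> :: "real measure"
  assumes "0 < a" and "0 < b" and "0 < c" and "c < 1"
    and "tempered_stable_subordinator M X a b c"
    and "\<alpha> = a / (2 * b powr (1 - c)) *
          (Gamma (1 - c) +
            (upper_Gamma (2 - c) b - 2 * upper_Gamma (1 - c) b - b\<^sup>2 * upper_Gamma (- c) b) / (c + 1))"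
    and "\<beta> = 0"
    and "l = (\<lambda>x. a / (c + 1) *
          (exp (- b * x) / x powr (c + 1) - b powr (c + 1) * upper_Gamma (- c) (b * x)) *
          indicator {0<..} x)"
    and "\<nu> = density lborel (\<lambda>x. ennreal (l x))"
  shows "l \<in> borel_measurable borel \<and> (\<forall>x. 0 \<le> l x) \<and> levy_measure \<nu> \<and>
    (\<forall>t\<ge>0.
      (\<exists>L. is_continuous_log (laplace_domain M (time_average X t))
              (laplace_transform M (time_average X t)) L) \<and>
      (\<forall>u\<in>laplace_domain M (time_average X t).
        (0 < t \<longrightarrow> set_integrable \<nu> (- {0}) (levy_khintchine_integrand u)) \<and>
        continuous_log (laplace_domain M (time_average X t))
              (laplace_transform M (time_average X t)) u =
          of_real t * levy_khintchine_exponent \<alpha> \<beta> \<nu> u))"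
proof -
  interpret tempered_stable_subordinator M X a b c by fact
  have b: "0 < b" and c: "0 < c" "c < 1" by fact+
  have l: "l = (\<lambda>x. a / (c + 1) * avg_density b c x * indicator {0<..} x)"
    using assms(8) by (simp add: avg_density_def)
  have \<alpha>: "\<alpha> = a / (c + 1) * (LBINT x:{0<..<1}. x * avg_density b c x)"
    using c unfolding assms(6) avg_density_first_moment[OF b c] by simp
  note LK = levy_khintchine_avg_density[OF assms(1-4) l assms(9), folded \<alpha>]
  show ?thesis
  proof (intro conjI allI impI)
    show "l \<in> borel_measurable borel" "0 \<le> l x" "levy_measure \<nu>" for x
      by (rule LK(1) LK(2) LK(3))+
    fix t :: real assume "0 \<le> t"
    define D where "D = laplace_domain M (time_average X t)"
    define L where "L u = of_real t * (of_real (a / (c + 1)) * avg_exponent b c u)" for u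
    have main: "\<exists>L. connected D \<and> 0 \<in> D \<and> is_continuous_log D (laplace_transform M (time_average X t)) L \<and>
        (\<forall>u\<in>D. (0 < t \<longrightarrow> set_integrable \<nu> (- {0}) (levy_khintchine_integrand u)) \<and>
          L u = of_real t * levy_khintchine_exponent \<alpha> \<beta> \<nu> u)"
    \<comment> \<open>The witness differs: at t = 0 the transform is constantly 1 on the whole
      plane, where continuity of \<open>avg_exponent\<close> has not been established, so the zero
      function serves as logarithm.\<close>
    proof (cases "t = 0")
      case True
      then have "D = UNIV" "laplace_transform M (time_average X t) = (\<lambda>_. 1)"
        by (auto simp: D_def laplace_domain_def laplace_transform_def time_average_def fun_eq_iff prob_space)
      then show ?thesis
        using True by (intro exI[of _ "\<lambda>_. 0"]) (auto simp: is_continuous_log_def)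
    next
      case False
      with \<open>0 \<le> t\<close> have t: "0 < t" by simp
      have D: "D = {u. - b \<le> Re u}"
        unfolding D_def by (rule laplace_domain_time_average) fact+
      have "continuous_on D L"
        unfolding D L_def by (intro continuous_intros continuous_on_avg_exponent b c)
      moreover have "exp (L u) = laplace_transform M (time_average X t) u" if "u \<in> D" for u
        using laplace_time_average(2)[OF b c t, of u] that by (simp add: D L_def mult.assoc)
      moreover have "L 0 = 0"
        using b c by (simp add: L_def)
      ultimately have "is_continuous_log D (laplace_transform M (time_average X t)) L"
        by (simp add: is_continuous_log_def)
      moreover have "connected D"
        unfolding D using convex_halfspace_Re_ge[of "- b"] by (intro convex_connected) simp
      ultimately show ?thesis
        using b LK(4,5) assms(7) by (intro exI[of _ L]) (auto simp: D L_def)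
    qed
    then show "\<exists>L. is_continuous_log (laplace_domain M (time_average X t)) (laplace_transform M (time_average X t)) L"
      unfolding D_def by blast
    show "\<forall>u\<in>laplace_domain M (time_average X t).
        (0 < t \<longrightarrow> set_integrable \<nu> (- {0}) (levy_khintchine_integrand u)) \<and>
        continuous_log (laplace_domain M (time_average X t)) (laplace_transform M (time_average X t)) u =
          of_real t * levy_khintchine_exponent \<alpha> \<beta> \<nu> u"
      using main continuous_log_eq unfolding D_def by metis
  qed
qed

end
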